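(* Consider the Gaussian white noise regression model in wavelet form: given $f$, one observes independently $X_{lk}\mid f_{lk}\sim\mathcal N(f_{lk},1/n)$ for $l\ge0$, $k\in\mathcal K_l$, and write $X^{(n)}=(X_{lk})_{l,k}$. Let $h$ be a probability density on $\mathbb R$ such that: (i) $h$ is symmetric, positive, bounded, and decreasing on $[0,\infty)$; (ii) for some $c_1>0$, $\kappa\ge0$, $\log(1/h(x))\le c_1(1+\log^{1+\kappa}(1+x))$ for all $x\ge0$; (iii) for some $c_2>0$, $\int_x^\infty h(u)\,du\le c_2/x^2$ for all $x\ge1$. Let $\Pi$ be the prior on $f$ under which $f_{lk}=s_l\zeta_{lk}$ with $(\zeta_{lk})$ i.i.d. of density $h$ and $s_l=2^{-l^2}$. Suppose $f_0\in\mathcal B^\beta_{rr}(L)$ for some $\beta,L>0$, $r\in[1,2]$ and $\beta>1/r-1/2$. Then, for any given $\rho\in(0,1)$, there exists $d>0$ such that, with $\mathcal L_n=(\log n)^d$, as $n\to\infty$, $$E_{f_0}\Pi_\rho\left[\{f:\ \|f-f_0\|_2>\mathcal L_n\,n^{-\frac{\beta}{2\beta+1}}\}\,\middle|\,X^{(n)}\right]\to0.$$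
   Context: $\{\psi_{lk}:l\ge0,k\in\mathcal K_l\}$, $\mathcal K_l=\{0,\dots,2^l-1\}$, is an orthonormal boundary-corrected wavelet basis of $L^2[0,1]$ (the scaling function being denoted as the first wavelet $\psi_{00}$). Functions are identified with their coefficients $f_{lk}=\langle f,\psi_{lk}\rangle$, so $\|f\|_2^2=\sum_{l,k}f_{lk}^2$. The Besov-type ball is $\mathcal B^\beta_{rr}(L)=\{f=(f_{lk}):\ \sum_{l\ge0}2^{rl(\beta+1/2-1/r)}\sum_{k\in\mathcal K_l}|f_{lk}|^r<L^r\}$. The $\rho$-posterior (tempered posterior) is $\Pi_\rho[B\mid X]=\int_B(p_f^{(n)}(X))^\rho\,d\Pi(f)\big/\int(p_f^{(n)}(X))^\rho\,d\Pi(f)$ for measurable $B$, where $p_f^{(n)}$ is the density of the law of the data under $f$ with respect to a common dominating measure; here, under $\Pi_\rho[\cdot\mid X^{(n)}]$ the $f_{lk}$ are independent, $f_{lk}$ having density proportional to $\theta\mapsto e^{-\rho n(X_{lk}-\theta)^2/2}h(\theta/s_l)$. $E_{f_0}$ is the expectation when $X_{lk}\sim\mathcal N(f_{0,lk},1/n)$ independently. *)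

theory Defs
  imports "HOL-Probability.Probability"
begin

text \<open>
  Functions in \<open>L\<^sup>2[0,1]\<close> are identified with their families of wavelet coefficients, indexed
  by pairs \<open>(l, k)\<close> with \<open>k \<in> {0, \<dots>, 2^l - 1}\<close>.  The values of a family outside this index set
  are irrelevant.
\<close>

type_synonym coeffs = "nat \<times> nat \<Rightarrow> real"

definition wav_idx :: "(nat \<times> nat) set" where
  "wav_idx = {(l, k). k < 2 ^ l}"

definition l2_space :: "coeffs set" where
  "l2_space = {f. (\<lambda>i. (f i)\<^sup>2) summable_on wav_idx}"

definition l2_norm :: "coeffs \<Rightarrow> ennreal" where
  "l2_norm f = (if f \<in> l2_space then ennreal (sqrt (\<Sum>\<^sub>\<infinity>i\<in>wav_idx. (f i)\<^sup>2)) else \<infinity>)"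

definition besov_ball :: "real \<Rightarrow> real \<Rightarrow> real \<Rightarrow> coeffs set" where
  "besov_ball \<beta> r L =
     {f. summable (\<lambda>l. 2 powr (r * real l * (\<beta> + 1/2 - 1/r)) * (\<Sum>k<2 ^ l. \<bar>f (l, k)\<bar> powr r)) \<and>
         (\<Sum>l. 2 powr (r * real l * (\<beta> + 1/2 - 1/r)) * (\<Sum>k<2 ^ l. \<bar>f (l, k)\<bar> powr r)) < L powr r}"

abbreviation coeff_borel :: "coeffs measure" where
  "coeff_borel \<equiv> PiM wav_idx (\<lambda>_. borel)"

text \<open>The law of the data \<open>X\<^sup>(\<^sup>n\<^sup>)\<close> under \<open>f\<close>; \<open>normal_density\<close> takes the standard deviation.\<close>

definition white_noise :: "nat \<Rightarrow> coeffs \<Rightarrow> coeffs measure" where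
  "white_noise n f =
     PiM wav_idx (\<lambda>i. density lborel (\<lambda>x. ennreal (normal_density (f i) (1 / sqrt (real n)) x)))"

definition series_prior :: "(nat \<Rightarrow> real) \<Rightarrow> (real \<Rightarrow> real) \<Rightarrow> coeffs measure" where
  "series_prior s h =
     distr (PiM wav_idx (\<lambda>_. density lborel (\<lambda>x. ennreal (h x)))) coeff_borel
       (\<lambda>\<zeta>. \<lambda>i\<in>wav_idx. s (fst i) * \<zeta> i)"

text \<open>
  \<open>p f\<close> is a version of the density of the law of the data under \<open>f\<close> with respect to the dominating
  measure \<open>\<mu>\<close>.  Joint measurability in \<open>(f, x)\<close> is what gives meaning to integrals of \<open>p f x\<close> over
  \<open>f\<close>.  The laws \<open>white_noise n f\<close> have a common dominating measure only for square-summable \<open>f\<close>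
  (for instance \<open>white_noise n (\<lambda>_. 0)\<close>), so nothing is required of \<open>p f\<close> for other \<open>f\<close>.
\<close>

definition is_likelihood ::
    "nat \<Rightarrow> coeffs measure \<Rightarrow> (coeffs \<Rightarrow> coeffs \<Rightarrow> real) \<Rightarrow> bool" where
  "is_likelihood n \<mu> p \<longleftrightarrow>
     sigma_finite_measure \<mu> \<and> sets \<mu> = sets coeff_borel \<and>
     (\<lambda>(f, x). p f x) \<in> borel_measurable (coeff_borel \<Otimes>\<^sub>M coeff_borel) \<and>
     (\<forall>f x. 0 \<le> p f x) \<and>
     (\<forall>f\<in>l2_space. white_noise n f = density \<mu> (\<lambda>x. ennreal (p f x)))"

definition tempered_posterior ::
    "real \<Rightarrow> ('f \<Rightarrow> 'x \<Rightarrow> real) \<Rightarrow> 'f measure \<Rightarrow> 'x \<Rightarrow> 'f set \<Rightarrow> ennreal" where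
  "tempered_posterior \<rho> p prior x B =
     (\<integral>\<^sup>+f\<in>B. ennreal (p f x powr \<rho>) \<partial>prior) / (\<integral>\<^sup>+f. ennreal (p f x powr \<rho>) \<partial>prior)"

end

theory Submission
  imports Defs "HOL-Real_Asymp.Real_Asymp"
begin

text \<open>
  Write \<open>Q\<close> for the law of the data under \<open>f\<^sub>0\<close>.  By Cameron--Martin, the likelihood ratio of \<open>f\<close>
  against \<open>f\<^sub>0\<close> has \<open>s\<close>-th moment at most \<open>exp (s (s - 1) n \<parallel>f - f\<^sub>0\<parallel>\<^sup>2 / 2)\<close> under \<open>Q\<close>, for every real
  \<open>s\<close>.  The exponent is negative for \<open>s = \<rho> \<in> (0, 1)\<close>, which bounds the numerator \<open>N\<close> of the tempered
  posterior far from \<open>f\<^sub>0\<close>; with \<open>s = - \<rho>\<close> and Cauchy--Schwarz it bounds the inverse of the denominator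
  \<open>D\<close>, restricted to a set \<open>E\<close> close to \<open>f\<^sub>0\<close>, in terms of the prior mass of \<open>E\<close>.  As
  \<open>min 1 (N / D) \<le> c N + 1 / (c D)\<close> for all \<open>c > 0\<close>, no testing argument is needed.

  For the prior mass let \<open>K = n\<^bsup>1 / (2 \<beta> + 1)\<^esup>\<close>.  The coefficients of \<open>f\<^sub>0\<close> that lie on the levels with
  \<open>2\<^sup>l \<le> K\<close> or exceed \<open>1 / sqrt n\<close> are \<open>O(K)\<close> in number and live on levels \<open>O(ln n)\<close>, so hitting one of them
  up to \<open>1 / sqrt n\<close> costs at most a factor \<open>exp (- C (ln n)\<^bsup>2 + 2 \<kappa>\<^esup>)\<close>, since \<open>ln (1 / s\<^sub>l)\<close> is of order
  \<open>l\<^sup>2\<close>.  The other coefficients of \<open>f\<^sub>0\<close> have squared norm \<open>O(K / n)\<close>, and there the prior draws are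
  small simultaneously with probability at least \<open>1 / 2\<close>.
\<close>

section \<open>Gaussian likelihood ratios\<close>

text \<open>Only coordinates in the finite set \<open>J\<close> enter, so the integral can be
  computed on the marginal over \<open>J\<close>, where independence factors it.\<close>

lemma (in product_prob_space) nn_integral_PiM_prod:
  assumes J: "finite J" "J \<subseteq> I" and g: "\<And>i. i \<in> J \<Longrightarrow> g i \<in> borel_measurable (M i)"
  shows "(\<integral>\<^sup>+x. (\<Prod>i\<in>J. g i (x i)) \<partial>PiM I M) = (\<Prod>i\<in>J. \<integral>\<^sup>+y. g i y \<partial>M i)"
proof -
  have [measurable]: "(\<lambda>x. \<Prod>i\<in>J. g i (x i)) \<in> borel_measurable (PiM J M)"
    using g by (intro borel_measurable_prod_ennreal measurable_compose[OF measurable_component_singleton]) auto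
  have "(\<integral>\<^sup>+x. (\<Prod>i\<in>J. g i (x i)) \<partial>PiM I M)
      = (\<integral>\<^sup>+x. (\<Prod>i\<in>J. g i (restrict x J i)) \<partial>PiM I M)"
    by (intro nn_integral_cong prod.cong) auto
  also have "\<dots> = (\<integral>\<^sup>+x. (\<Prod>i\<in>J. g i (x i)) \<partial>distr (PiM I M) (PiM J M) (\<lambda>x. restrict x J))"
    using J by (subst nn_integral_distr) (auto intro!: measurable_restrict_subset)
  also have "\<dots> = (\<Prod>i\<in>J. \<integral>\<^sup>+y. g i y \<partial>M i)"
    using J g by (simp add: distr_PiM_restrict_finite product_nn_integral_prod)
  finally show ?thesis .
qed

abbreviation obs_law :: "nat \<Rightarrow> real \<Rightarrow> real measure" where
  "obs_law n m \<equiv> density lborel (\<lambda>x. ennreal (normal_density m (1 / sqrt (real n)) x))"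

lemma prob_space_obs_law: "1 \<le> n \<Longrightarrow> prob_space (obs_law n m)"
  by (rule prob_space_normal_density) simp

text \<open>Completing the square: exponential tilting of a normal density with variance
  \<open>1 / n\<close> moves its mean by \<open>b / n\<close>, up to a normalising constant.\<close>

lemma normal_density_tilt:
  assumes "1 \<le> n"
  shows "normal_density m (1 / sqrt (real n)) x * exp (b * (x - m))
    = exp (b\<^sup>2 / (2 * real n)) * normal_density (m + b / real n) (1 / sqrt (real n)) x"
proof -
  have n: "real n > 0" using assms by simp
  have "- (x - m)\<^sup>2 * real n / 2 + b * (x - m)
      = b\<^sup>2 / (2 * real n) - (x - (m + b / real n))\<^sup>2 * real n / 2"
    using n by (simp add: field_simps power2_eq_square)
  then show ?thesis
    using n by (simp add: normal_density_def power_divide exp_add[symmetric] mult_ac)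
qed

lemma nn_integral_obs_law_exp:
  assumes "1 \<le> n"
  shows "(\<integral>\<^sup>+x. ennreal (exp (b * (x - m))) \<partial>obs_law n m) = ennreal (exp (b\<^sup>2 / (2 * real n)))"
proof -
  interpret P: prob_space "obs_law n (m + b / real n)" by (rule prob_space_obs_law[OF assms])
  have "(\<integral>\<^sup>+x. ennreal (exp (b * (x - m))) \<partial>obs_law n m)
     = (\<integral>\<^sup>+x. ennreal (normal_density m (1 / sqrt (real n)) x * exp (b * (x - m))) \<partial>lborel)"
    by (subst nn_integral_density) (auto simp: ennreal_mult)
  also have "\<dots> = (\<integral>\<^sup>+x. ennreal (exp (b\<^sup>2 / (2 * real n))) *
      ennreal (normal_density (m + b / real n) (1 / sqrt (real n)) x) \<partial>lborel)"
    by (simp add: normal_density_tilt[OF assms] ennreal_mult)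
  also have "\<dots> = ennreal (exp (b\<^sup>2 / (2 * real n))) * emeasure (obs_law n (m + b / real n)) UNIV"
    by (subst nn_integral_cmult) (auto simp: emeasure_density)
  also have "\<dots> = ennreal (exp (b\<^sup>2 / (2 * real n)))"
    using P.emeasure_space_1 by simp
  finally show ?thesis .
qed

text \<open>Cameron-Martin in one coordinate: this is the tilt with \<open>b = n * d\<close>, whose
  constant cancels the quadratic term in the exponent.\<close>

lemma nn_integral_obs_law_shift:
  assumes n: "1 \<le> n" and A: "A \<in> sets borel"
  shows "(\<integral>\<^sup>+x. ennreal (exp (real n * d * (x - m) - real n * d\<^sup>2 / 2)) * indicator A x \<partial>obs_law n m)
    = emeasure (obs_law n (m + d)) A"
proof -
  have *: "normal_density m (1 / sqrt (real n)) x * exp (real n * d * (x - m) - real n * d\<^sup>2 / 2)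
      = normal_density (m + d) (1 / sqrt (real n)) x" for x
  proof -
    have e: "(real n * d)\<^sup>2 / (2 * real n) = real n * d\<^sup>2 / 2"
      using n by (simp add: power2_eq_square field_simps)
    have "normal_density m (1 / sqrt (real n)) x * exp (real n * d * (x - m)) / exp (real n * d\<^sup>2 / 2)
        = normal_density (m + d) (1 / sqrt (real n)) x"
      unfolding normal_density_tilt[OF n] e using n by simp
    then show ?thesis by (simp add: exp_diff)
  qed
  have "(\<integral>\<^sup>+x. ennreal (exp (real n * d * (x - m) - real n * d\<^sup>2 / 2)) * indicator A x \<partial>obs_law n m)
     = (\<integral>\<^sup>+x. ennreal (normal_density m (1 / sqrt (real n)) x *
          exp (real n * d * (x - m) - real n * d\<^sup>2 / 2)) * indicator A x \<partial>lborel)"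
    using A by (subst nn_integral_density) (auto simp: ennreal_mult mult_ac)
  also have "\<dots> = emeasure (obs_law n (m + d)) A"
    using A by (simp add: * emeasure_density)
  finally show ?thesis .
qed

section \<open>Finite truncations of the index set and square summability\<close>

definition levels :: "nat \<Rightarrow> (nat \<times> nat) set" where
  "levels N = (SIGMA l:{..<N}. {..<2 ^ l})"

lemma finite_levels [simp]: "finite (levels N)"
  by (simp add: levels_def)

lemma levels_subset: "levels N \<subseteq> wav_idx"
  by (auto simp: levels_def wav_idx_def)

lemma levels_mono: "N \<le> N' \<Longrightarrow> levels N \<subseteq> levels N'"
  by (auto simp: levels_def)

lemma wav_idx_eq_Union_levels: "wav_idx = (\<Union>N. levels N)"
  by (auto simp: levels_def wav_idx_def)

lemma finite_subset_levels:
  assumes "finite J" "J \<subseteq> wav_idx"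
  obtains N where "J \<subseteq> levels N"
proof -
  have "l \<le> Max (fst ` J)" if "(l, k) \<in> J" for l k
    using assms(1) that by (metis Max_ge finite_imageI fst_conv image_eqI)
  then have "J \<subseteq> levels (Suc (Max (fst ` J)))"
    using assms(2) by (auto simp: levels_def wav_idx_def less_Suc_eq_le)
  then show thesis by (rule that)
qed

text \<open>\<open>infsum\<close> is a limit along the net of all finite subsets; every finite
  subset lies in some \<open>levels N\<close>, so the sequence of truncations suffices to compute
  it.\<close>

lemma filterlim_levels: "filterlim levels (finite_subsets_at_top wav_idx) sequentially"
  unfolding filterlim_finite_subsets_at_top
proof (intro allI impI)
  fix X :: "(nat \<times> nat) set" assume X: "finite X \<and> X \<subseteq> wav_idx"
  then obtain N where "X \<subseteq> levels N" using finite_subset_levels by blast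
  then show "\<forall>\<^sub>F y in sequentially. finite (levels y) \<and> X \<subseteq> levels y \<and> levels y \<subseteq> wav_idx"
    using levels_mono levels_subset
    by (intro eventually_sequentiallyI[of N]) (meson finite_levels subset_trans)
qed

lemma summable_on_levels_tendsto:
  fixes g :: "nat \<times> nat \<Rightarrow> real"
  assumes "g summable_on wav_idx"
  shows "(\<lambda>N. \<Sum>i\<in>levels N. g i) \<longlonglongrightarrow> infsum g wav_idx"
  using filterlim_compose[OF infsum_tendsto[OF assms] filterlim_levels] .

lemma l2_space_diff:
  assumes "f \<in> l2_space" "g \<in> l2_space"
  shows "(\<lambda>i. f i - g i) \<in> l2_space"
proof -
  have "(\<lambda>i. 2 * (f i)\<^sup>2 + 2 * (g i)\<^sup>2) summable_on wav_idx"
    using assms by (intro summable_on_add summable_on_cmult_right) (auto simp: l2_space_def)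
  moreover have "(f i - g i)\<^sup>2 \<le> 2 * (f i)\<^sup>2 + 2 * (g i)\<^sup>2" for i
    using zero_le_power2[of "f i + g i"] by (simp add: power2_eq_square algebra_simps)
  ultimately show ?thesis
    unfolding l2_space_def by (auto intro: summable_on_comparison_test)
qed

text \<open>Squares are nonnegative, so bounded partial sums already give summability. This form
  involves only finite sums and therefore also serves to prove measurability.\<close>

lemma l2_space_iff_bounded:
  "f \<in> l2_space \<longleftrightarrow> (\<exists>C. \<forall>N. (\<Sum>i\<in>levels N. (f i)\<^sup>2) \<le> C)"
proof
  assume f: "f \<in> l2_space"
  have "(\<Sum>i\<in>levels N. (f i)\<^sup>2) \<le> infsum (\<lambda>i. (f i)\<^sup>2) wav_idx" for N
    using f levels_subset by (intro finite_sum_le_infsum) (auto simp: l2_space_def)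
  then show "\<exists>C. \<forall>N. (\<Sum>i\<in>levels N. (f i)\<^sup>2) \<le> C" by blast
next
  assume "\<exists>C. \<forall>N. (\<Sum>i\<in>levels N. (f i)\<^sup>2) \<le> C"
  then obtain C where C: "\<And>N. (\<Sum>i\<in>levels N. (f i)\<^sup>2) \<le> C" by blast
  have "(\<Sum>i\<in>F. (f i)\<^sup>2) \<le> C" if F: "F \<subseteq> wav_idx" "finite F" for F
  proof -
    obtain N where "F \<subseteq> levels N" using F finite_subset_levels by blast
    then have "(\<Sum>i\<in>F. (f i)\<^sup>2) \<le> (\<Sum>i\<in>levels N. (f i)\<^sup>2)" by (intro sum_mono2) auto
    with C[of N] show ?thesis by simp
  qed
  then show "f \<in> l2_space"
    unfolding l2_space_def
    by (auto intro!: nonneg_bdd_above_summable_on bdd_aboveI2)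
qed

lemma infsum_square_le:
  assumes "\<And>N. (\<Sum>i\<in>levels N. (f i)\<^sup>2) \<le> (C::real)"
  shows "infsum (\<lambda>i. (f i)\<^sup>2) wav_idx \<le> C"
proof -
  have "f \<in> l2_space" using assms l2_space_iff_bounded by blast
  then show ?thesis
    using assms by (intro LIMSEQ_le_const2[OF summable_on_levels_tendsto]) (auto simp: l2_space_def)
qed

text \<open>Expresses the loss event through countably many finite sums, which makes it measurable.
  Families outside \<open>l2_space\<close> have infinite norm and unbounded partial sums, so they
  fit both sides.\<close>

lemma l2_norm_gt_iff:
  assumes "0 \<le> \<tau>"
  shows "l2_norm f > ennreal \<tau> \<longleftrightarrow> (\<exists>N. (\<Sum>i\<in>levels N. (f i)\<^sup>2) > \<tau>\<^sup>2)"
proof (cases "f \<in> l2_space")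
  case True
  let ?T = "infsum (\<lambda>i. (f i)\<^sup>2) wav_idx"
  have T: "0 \<le> ?T" by (intro infsum_nonneg) auto
  have "l2_norm f > ennreal \<tau> \<longleftrightarrow> \<tau> < sqrt ?T"
    using True assms by (simp add: l2_norm_def ennreal_less_iff)
  also have "\<dots> \<longleftrightarrow> \<tau>\<^sup>2 < ?T"
    using assms T by (metis real_less_rsqrt real_sqrt_unique real_sqrt_less_iff)
  also have "\<dots> \<longleftrightarrow> (\<exists>N. (\<Sum>i\<in>levels N. (f i)\<^sup>2) > \<tau>\<^sup>2)"
  proof
    assume "\<tau>\<^sup>2 < ?T"
    then have "eventually (\<lambda>N. \<tau>\<^sup>2 < (\<Sum>i\<in>levels N. (f i)\<^sup>2)) sequentially"
      using True by (intro order_tendstoD(1)[OF summable_on_levels_tendsto]) (auto simp: l2_space_def)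
    then show "\<exists>N. (\<Sum>i\<in>levels N. (f i)\<^sup>2) > \<tau>\<^sup>2"
      by (metis eventually_happens' sequentially_bot)
  next
    assume "\<exists>N. (\<Sum>i\<in>levels N. (f i)\<^sup>2) > \<tau>\<^sup>2"
    moreover have "(\<Sum>i\<in>levels N. (f i)\<^sup>2) \<le> ?T" for N
      using True levels_subset by (intro finite_sum_le_infsum) (auto simp: l2_space_def)
    ultimately show "\<tau>\<^sup>2 < ?T" by (meson less_le_trans)
  qed
  finally show ?thesis .
next
  case False
  then have "\<exists>N. (\<Sum>i\<in>levels N. (f i)\<^sup>2) > \<tau>\<^sup>2"
    unfolding l2_space_iff_bounded by (meson not_le)
  with False show ?thesis by (simp add: l2_norm_def)
qed

section \<open>Likelihood ratios on finitely many levels\<close>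

locale white_noise_pair =
  fixes n :: nat and f f0 :: coeffs
  assumes n: "1 \<le> n" and f: "f \<in> l2_space" and f0: "f0 \<in> l2_space"
begin

definition shift :: "nat \<times> nat \<Rightarrow> real" where
  "shift i = f i - f0 i"

text \<open>The variance of \<open>ln (lr N x)\<close> when \<open>x\<close> has law
  \<open>white_noise n f0\<close>.\<close>

definition energy :: "nat \<Rightarrow> real" where
  "energy N = real n * (\<Sum>i\<in>levels N. (shift i)\<^sup>2)"

definition total_energy :: real where
  "total_energy = real n * infsum (\<lambda>i. (f i - f0 i)\<^sup>2) wav_idx"

text \<open>The likelihood ratio of \<open>f\<close> against \<open>f0\<close> when only the
  coefficients in \<open>levels N\<close> are observed, as a product of one-coordinate
  ratios.\<close>

definition lr :: "nat \<Rightarrow> coeffs \<Rightarrow> real" where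
  "lr N x = exp (\<Sum>i\<in>levels N. real n * shift i * (x i - f0 i) - real n * (shift i)\<^sup>2 / 2)"

sublocale Q: product_prob_space "\<lambda>i. obs_law n (f0 i)" wav_idx
  by (intro product_prob_spaceI prob_space_obs_law n)

lemma white_noise_eq: "white_noise n f0 = PiM wav_idx (\<lambda>i. obs_law n (f0 i))"
  by (simp add: white_noise_def)

lemma sets_white_noise [measurable_cong]: "sets (white_noise n g) = sets coeff_borel"
  unfolding white_noise_def by (intro sets_PiM_cong) auto

lemma prob_space_white_noise: "prob_space (white_noise n g)"
  unfolding white_noise_def by (intro prob_space_PiM prob_space_obs_law n)

lemma component_measurable:
  "i \<in> levels N \<Longrightarrow> (\<lambda>x. x i) \<in> borel_measurable coeff_borel"
  using levels_subset by (intro measurable_component_singleton) auto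

lemma lr_measurable [measurable]: "lr N \<in> borel_measurable coeff_borel"
proof -
  note component_measurable[measurable]
  show ?thesis unfolding lr_def by measurable
qed

lemma nn_integral_white_noise_exp:
  assumes J: "finite J" "J \<subseteq> wav_idx"
  shows "(\<integral>\<^sup>+x. ennreal (exp (\<Sum>i\<in>J. b i * (x i - f0 i))) \<partial>white_noise n f0)
    = ennreal (exp (\<Sum>i\<in>J. (b i)\<^sup>2 / (2 * real n)))"
proof -
  have "(\<integral>\<^sup>+x. ennreal (exp (\<Sum>i\<in>J. b i * (x i - f0 i))) \<partial>white_noise n f0)
     = (\<integral>\<^sup>+x. (\<Prod>i\<in>J. ennreal (exp (b i * (x i - f0 i)))) \<partial>white_noise n f0)"
    using J by (simp add: exp_sum prod_ennreal)
  also have "\<dots> = (\<Prod>i\<in>J. ennreal (exp ((b i)\<^sup>2 / (2 * real n))))"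
    unfolding white_noise_eq
    by (subst Q.nn_integral_PiM_prod[OF J]) (simp_all add: nn_integral_obs_law_exp[OF n])
  also have "\<dots> = ennreal (exp (\<Sum>i\<in>J. (b i)\<^sup>2 / (2 * real n)))"
    using J by (simp add: exp_sum prod_ennreal)
  finally show ?thesis .
qed

text \<open>Under \<open>f0\<close>, \<open>ln (lr N x)\<close> is normal with mean
  \<open>- energy N / 2\<close> and variance \<open>energy N\<close>; the formula is its Laplace
  transform at \<open>s\<close>, valid for every real \<open>s\<close>.\<close>

lemma nn_integral_lr_powr:
  "(\<integral>\<^sup>+x. ennreal (lr N x powr s) \<partial>white_noise n f0) = ennreal (exp (s * (s - 1) / 2 * energy N))"
proof -
  have "lr N x powr s = exp (- s / 2 * energy N) * exp (\<Sum>i\<in>levels N. (s * real n * shift i) * (x i - f0 i))" for x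
    by (simp add: lr_def powr_def energy_def sum_subtractf sum_distrib_left right_diff_distrib
        exp_add[symmetric] mult_ac sum_divide_distrib sum_negf)
  then have "(\<integral>\<^sup>+x. ennreal (lr N x powr s) \<partial>white_noise n f0)
    = ennreal (exp (- s / 2 * energy N)) *
      (\<integral>\<^sup>+x. ennreal (exp (\<Sum>i\<in>levels N. (s * real n * shift i) * (x i - f0 i))) \<partial>white_noise n f0)"
  proof -
    note component_measurable[measurable]
    show ?thesis
      unfolding \<open>\<And>x. lr N x powr s = _ x\<close>
      by (subst nn_integral_cmult[symmetric]) (auto simp: ennreal_mult)
  qed
  also have "\<dots> = ennreal (exp (- s / 2 * energy N) * exp (\<Sum>i\<in>levels N. (s * real n * shift i)\<^sup>2 / (2 * real n)))"
    by (subst nn_integral_white_noise_exp) (auto simp: levels_subset ennreal_mult)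
  also have "(\<Sum>i\<in>levels N. (s * real n * shift i)\<^sup>2 / (2 * real n)) = s\<^sup>2 / 2 * energy N"
    using n by (simp add: energy_def sum_distrib_left power2_eq_square field_simps)
  also have "exp (- s / 2 * energy N) * exp (s\<^sup>2 / 2 * energy N) = exp (s * (s - 1) / 2 * energy N)"
    by (simp add: exp_add[symmetric] power2_eq_square algebra_simps diff_divide_distrib)
  finally show ?thesis .
qed

text \<open>The sequence \<open>lr\<close> is a martingale under \<open>f0\<close>, so the mixed
  moment is the second moment of the earlier term.\<close>

lemma nn_integral_lr_mult:
  assumes "M \<le> N"
  shows "(\<integral>\<^sup>+x. ennreal (lr M x * lr N x) \<partial>white_noise n f0) = ennreal (exp (energy M))"
proof -
  \<comment> \<open>Coordinates in \<open>levels M\<close> occur in both factors, so their exponent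
    is doubled. Its square contributes 4 = 1 + 3, which is the origin of the term
    \<open>3 / 2 * energy M\<close> below.\<close>
  define b where "b i = real n * shift i * (1 + of_bool (i \<in> levels M))" for i
  have sub: "levels M \<subseteq> levels N" using levels_mono assms .
  then have Int: "levels N \<inter> levels M = levels M" by auto
  have extend: "(\<Sum>i\<in>levels M. g i) = (\<Sum>i\<in>levels N. of_bool (i \<in> levels M) * g i)" for g :: "nat \<times> nat \<Rightarrow> real"
    using sum.inter_restrict[OF finite_levels, of g N "levels M"] Int
    by (simp add: of_bool_def if_distrib[of "\<lambda>x. x * _"] cong: if_cong)
  have "lr M x * lr N x = exp (- (energy M + energy N) / 2) * exp (\<Sum>i\<in>levels N. b i * (x i - f0 i))" for x
  proof -
    have "(\<Sum>i\<in>levels N. b i * (x i - f0 i)) =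
       (\<Sum>i\<in>levels N. real n * shift i * (x i - f0 i)) + (\<Sum>i\<in>levels M. real n * shift i * (x i - f0 i))"
      unfolding extend sum.distrib[symmetric] by (intro sum.cong) (auto simp: b_def algebra_simps)
    then show ?thesis
      by (simp add: lr_def energy_def sum_subtractf exp_add[symmetric] add_divide_distrib
          flip: sum_divide_distrib sum_distrib_left)
  qed
  then have "(\<integral>\<^sup>+x. ennreal (lr M x * lr N x) \<partial>white_noise n f0)
    = ennreal (exp (- (energy M + energy N) / 2)) *
      (\<integral>\<^sup>+x. ennreal (exp (\<Sum>i\<in>levels N. b i * (x i - f0 i))) \<partial>white_noise n f0)"
  proof -
    note component_measurable[measurable]
    show ?thesis
      unfolding \<open>\<And>x. lr M x * lr N x = _ x\<close>
      by (subst nn_integral_cmult[symmetric]) (auto simp: ennreal_mult)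
  qed
  also have "\<dots> = ennreal (exp (- (energy M + energy N) / 2) * exp (\<Sum>i\<in>levels N. (b i)\<^sup>2 / (2 * real n)))"
    by (subst nn_integral_white_noise_exp) (auto simp: levels_subset ennreal_mult)
  also have "(\<Sum>i\<in>levels N. (b i)\<^sup>2 / (2 * real n)) = energy N / 2 + 3 / 2 * energy M"
  proof -
    have "(\<Sum>i\<in>levels N. (b i)\<^sup>2 / (2 * real n)) =
      (\<Sum>i\<in>levels N. real n / 2 * (shift i)\<^sup>2 + of_bool (i \<in> levels M) * (3 / 2 * real n * (shift i)\<^sup>2))"
      using n by (intro sum.cong) (auto simp: b_def power2_eq_square field_simps)
    also have "\<dots> = (\<Sum>i\<in>levels N. real n / 2 * (shift i)\<^sup>2) + (\<Sum>i\<in>levels M. 3 / 2 * real n * (shift i)\<^sup>2)"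
      unfolding extend sum.distrib ..
    finally show ?thesis
      by (simp add: energy_def sum_distrib_left mult_ac)
  qed
  also have "exp (- (energy M + energy N) / 2) * exp (energy N / 2 + 3 / 2 * energy M) = exp (energy M)"
    by (simp add: exp_add[symmetric] field_simps)
  finally show ?thesis .
qed

lemma lr_pos: "0 < lr N x" by (simp add: lr_def)

lemma integrable_lr_mult:
  assumes "M \<le> N"
  shows "integrable (white_noise n f0) (\<lambda>x. lr M x * lr N x)"
    and "(\<integral>x. lr M x * lr N x \<partial>white_noise n f0) = exp (energy M)"
proof -
  have "(\<lambda>x. lr M x * lr N x) \<in> borel_measurable (white_noise n f0)" by measurable
  moreover have "AE x in white_noise n f0. 0 \<le> lr M x * lr N x"
    by (intro AE_I2 mult_nonneg_nonneg less_imp_le lr_pos)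
  ultimately have "integrable (white_noise n f0) (\<lambda>x. lr M x * lr N x) \<and>
      (\<integral>x. lr M x * lr N x \<partial>white_noise n f0) = exp (energy M)"
    using nn_integral_lr_mult[OF assms] by (subst nn_integral_eq_integrable[symmetric]) auto
  then show "integrable (white_noise n f0) (\<lambda>x. lr M x * lr N x)"
    and "(\<integral>x. lr M x * lr N x \<partial>white_noise n f0) = exp (energy M)" by auto
qed

lemma integrable_lr: "integrable (white_noise n f0) (lr N)"
proof (rule integrableI_nn_integral_finite)
  show "(\<integral>\<^sup>+x. ennreal (lr N x) \<partial>white_noise n f0) = ennreal 1"
    using nn_integral_lr_powr[of N 1] lr_pos[of N] by (simp add: less_imp_le)
  show "lr N \<in> borel_measurable (white_noise n f0)" by measurable
  show "AE x in white_noise n f0. 0 \<le> lr N x"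
    by (intro AE_I2 less_imp_le lr_pos)
qed


lemma energy_tendsto: "energy \<longlonglongrightarrow> total_energy"
proof -
  have "(\<lambda>i. (f i - f0 i)\<^sup>2) summable_on wav_idx"
    using l2_space_diff[OF f f0] by (simp add: l2_space_def)
  from summable_on_levels_tendsto[OF this] show ?thesis
    unfolding energy_def[abs_def] total_energy_def shift_def by (intro tendsto_intros)
qed

text \<open>Martingale increments are orthogonal, so the second moment of the difference is
  \<open>exp (energy N) - exp (energy M)\<close>. The inequality
  \<open>\<bar>t\<bar> \<le> a + t^2 / a\<close> passes from L2 to L1 without square roots.\<close>

lemma lr_diff_L1_le:
  assumes "M \<le> N" "0 < a"
  shows "(\<integral>x. \<bar>lr N x - lr M x\<bar> \<partial>white_noise n f0) \<le> a + (exp (energy N) - exp (energy M)) / a"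
proof -
  interpret prob_space "white_noise n f0" by (rule prob_space_white_noise)
  have sq: "(lr N x - lr M x)\<^sup>2 = lr N x * lr N x - 2 * (lr M x * lr N x) + lr M x * lr M x" for x
    by (simp add: power2_eq_square algebra_simps)
  have amgm: "\<bar>t\<bar> \<le> a + t\<^sup>2 / a" for t
  proof -
    have "0 \<le> (\<bar>t\<bar> - a)\<^sup>2 + \<bar>t\<bar> * a" using assms by simp
    then show ?thesis using assms by (simp add: power2_eq_square field_simps)
  qed
  have int: "integrable (white_noise n f0) (\<lambda>x. a + (lr N x - lr M x)\<^sup>2 / a)"
    unfolding sq using integrable_lr_mult assms
    by (auto intro!: Bochner_Integration.integrable_add Bochner_Integration.integrable_diff)
  have "(\<integral>x. \<bar>lr N x - lr M x\<bar> \<partial>white_noise n f0) \<le> (\<integral>x. a + (lr N x - lr M x)\<^sup>2 / a \<partial>white_noise n f0)"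
    by (intro integral_mono int amgm) (auto intro!: integrable_lr)
  also have "\<dots> = a + (exp (energy N) - exp (energy M)) / a"
    unfolding sq using integrable_lr_mult assms by (simp add: prob_space field_simps)
  finally show ?thesis .
qed

text \<open>The energies converge, hence so do their exponentials; once these differ by less than
  \<open>(e / 2)^2\<close>, the preceding bound with \<open>a = e / 2\<close> is below
  \<open>e\<close>.\<close>

lemma lr_Cauchy_L1:
  assumes "0 < e"
  shows "\<exists>K. \<forall>i\<ge>K. \<forall>j\<ge>K. (\<integral>x. norm (lr i x - lr j x) \<partial>white_noise n f0) < e"
proof -
  have "(\<lambda>N. exp (energy N)) \<longlonglongrightarrow> exp total_energy"
    by (intro tendsto_intros energy_tendsto)
  then have "Cauchy (\<lambda>N. exp (energy N))" by (rule LIMSEQ_imp_Cauchy)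
  then obtain K where K: "\<And>i j. i \<ge> K \<Longrightarrow> j \<ge> K \<Longrightarrow> \<bar>exp (energy i) - exp (energy j)\<bar> < (e / 2)\<^sup>2"
    using assms unfolding Cauchy_def by (metis dist_real_def zero_less_power half_gt_zero)
  have *: "(\<integral>x. norm (lr i x - lr j x) \<partial>white_noise n f0) < e" if "i \<ge> K" "j \<ge> K" "j \<le> i" for i j
  proof -
    have "(\<integral>x. norm (lr i x - lr j x) \<partial>white_noise n f0) \<le> e / 2 + (exp (energy i) - exp (energy j)) / (e / 2)"
      using lr_diff_L1_le[of j i "e / 2"] that assms by simp
    also have "(exp (energy i) - exp (energy j)) / (e / 2) < (e / 2)\<^sup>2 / (e / 2)"
      using K[OF that(1,2)] assms by (intro divide_strict_right_mono) auto
    also have "(e / 2)\<^sup>2 / (e / 2) = e / 2" using assms by (simp add: power2_eq_square)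
    finally show ?thesis by simp
  qed
  have "(\<integral>x. norm (lr i x - lr j x) \<partial>white_noise n f0) < e" if "i \<ge> K" "j \<ge> K" for i j
    using *[of i j] *[of j i] that by (cases "j \<le> i") (auto simp: abs_minus_commute)
  then show ?thesis by blast
qed

text \<open>Weighting by \<open>lr N\<close> shifts every coordinate in \<open>levels N\<close> from
  \<open>f0\<close> to \<open>f\<close>, and a box based in \<open>levels N\<close> does not see the
  remaining coordinates.\<close>

lemma emeasure_box_lr:
  assumes J: "finite J" "J \<subseteq> levels N" and A: "\<And>i. i \<in> J \<Longrightarrow> A i \<in> sets borel"
  shows "(\<integral>\<^sup>+x. ennreal (lr N x) * indicator (prod_emb wav_idx (\<lambda>_. borel) J (Pi\<^sub>E J A)) x \<partial>white_noise n f0)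
    = (\<Prod>i\<in>J. emeasure (obs_law n (f i)) (A i))"
proof -
  \<comment> \<open>The box is padded with \<open>UNIV\<close> on the rest of
    \<open>levels N\<close>; the padding contributes factors 1 on both sides.\<close>
  define B where "B i = (if i \<in> J then A i else UNIV)" for i
  have B: "B i \<in> sets borel" for i using A by (auto simp: B_def)
  let ?g = "\<lambda>i y. ennreal (exp (real n * shift i * (y - f0 i) - real n * (shift i)\<^sup>2 / 2)) * indicator (B i) y"
  have prod_B: "(\<Prod>i\<in>levels N. c i (B i)) = (\<Prod>i\<in>J. c i (A i))" if "\<And>i. c i UNIV = (1::ennreal)" for c
  proof -
    have "(\<Prod>i\<in>levels N. c i (B i)) = (\<Prod>i\<in>J. c i (B i))"
      using J that by (intro prod.mono_neutral_right) (auto simp: B_def)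
    then show ?thesis by (simp add: B_def)
  qed
  have "ennreal (lr N x) * indicator (prod_emb wav_idx (\<lambda>_. borel) J (Pi\<^sub>E J A)) x = (\<Prod>i\<in>levels N. ?g i (x i))"
    if "x \<in> space (white_noise n f0)" for x
  proof -
    have "x \<in> extensional wav_idx"
      using that sets_eq_imp_space_eq[OF sets_white_noise[of f0]] by (simp add: space_PiM PiE_def)
    then have "indicator (prod_emb wav_idx (\<lambda>_. borel) J (Pi\<^sub>E J A)) x = (\<Prod>i\<in>J. indicator (A i) (x i) :: ennreal)"
      using J(1) by (auto simp: prod_emb_def indicator_def PiE_iff Pi_iff space_PiM)
    also have "\<dots> = (\<Prod>i\<in>levels N. indicator (B i) (x i))"
      using prod_B[of "\<lambda>i A. indicator A (x i)"] by simp
    finally show ?thesis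
      by (simp add: prod.distrib lr_def exp_sum prod_ennreal)
  qed
  then have "(\<integral>\<^sup>+x. ennreal (lr N x) * indicator (prod_emb wav_idx (\<lambda>_. borel) J (Pi\<^sub>E J A)) x \<partial>white_noise n f0)
    = (\<integral>\<^sup>+x. (\<Prod>i\<in>levels N. ?g i (x i)) \<partial>white_noise n f0)"
    by (rule nn_integral_cong)
  also have "\<dots> = (\<Prod>i\<in>levels N. emeasure (obs_law n (f i)) (B i))"
    unfolding white_noise_eq using B
    by (subst Q.nn_integral_PiM_prod) (auto simp: levels_subset nn_integral_obs_law_shift[OF n] shift_def intro!: prod.cong)
  also have "\<dots> = (\<Prod>i\<in>J. emeasure (obs_law n (f i)) (A i))"
    using prob_space.emeasure_space_1[OF prob_space_obs_law[OF n]] by (intro prod_B) simp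
  finally show ?thesis .
qed

end

section \<open>Passage to infinitely many levels: the Cameron-Martin theorem\<close>

lemma nn_integral_AE_limit_le:
  fixes u :: "nat \<Rightarrow> 'a \<Rightarrow> ennreal"
  assumes [measurable]: "\<And>k. u k \<in> borel_measurable M"
    and lim: "AE x in M. (\<lambda>k. u k x) \<longlonglongrightarrow> v x"
    and C: "liminf (\<lambda>k. \<integral>\<^sup>+x. u k x \<partial>M) \<le> C"
  shows "(\<integral>\<^sup>+x. v x \<partial>M) \<le> C"
proof -
  have "(\<integral>\<^sup>+x. v x \<partial>M) = (\<integral>\<^sup>+x. liminf (\<lambda>k. u k x) \<partial>M)"
    using lim by (intro nn_integral_cong_AE) (auto elim!: eventually_mono dest!: lim_imp_Liminf[rotated])
  also have "\<dots> \<le> C"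
    using nn_integral_liminf[of u M] C by (meson assms(1) order_trans)
  finally show ?thesis .
qed

context white_noise_pair
begin

text \<open>For large \<open>k\<close> the box identity holds exactly with \<open>lr (r k)\<close>,
  so replacing it by the L1 limit \<open>Z\<close> costs at most \<open>e\<close>, for every
  \<open>e > 0\<close>.\<close>

lemma emeasure_box_limit:
  assumes Z: "Z \<in> borel_measurable coeff_borel" "\<And>x. 0 \<le> Z x" and r: "strict_mono r"
    and L1: "\<And>e. 0 < e \<Longrightarrow> eventually (\<lambda>k. (\<integral>\<^sup>+x. ennreal \<bar>lr (r k) x - Z x\<bar> \<partial>white_noise n f0) \<le> ennreal e) sequentially"
    and J: "finite J" "J \<subseteq> wav_idx" and A: "\<And>i. i \<in> J \<Longrightarrow> A i \<in> sets borel"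
  shows "(\<integral>\<^sup>+x. ennreal (Z x) * indicator (prod_emb wav_idx (\<lambda>_. borel) J (Pi\<^sub>E J A)) x \<partial>white_noise n f0)
    = (\<Prod>i\<in>J. emeasure (obs_law n (f i)) (A i))" (is "?a = ?c")
proof -
  let ?B = "prod_emb wav_idx (\<lambda>_. borel) J (Pi\<^sub>E J A) :: coeffs set"
  note Z(1)[measurable]
  have [measurable]: "?B \<in> sets coeff_borel"
    using J A by (intro sets_PiM_I) auto
  obtain N where N: "J \<subseteq> levels N" using J finite_subset_levels by blast
  have approx: "?a \<le> ?c + ennreal e \<and> ?c \<le> ?a + ennreal e" if e: "0 < e" for e
  proof -
    obtain k where k: "k \<ge> N" "(\<integral>\<^sup>+x. ennreal \<bar>lr (r k) x - Z x\<bar> \<partial>white_noise n f0) \<le> ennreal e"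
      using eventually_happens'[OF sequentially_bot eventually_conj[OF L1[OF e] eventually_ge_at_top[of N]]] by blast
    have "r k \<ge> N" using k(1) seq_suble[OF r, of k] by simp
    with N have "J \<subseteq> levels (r k)" using levels_mono by blast
    then have box: "(\<integral>\<^sup>+x. ennreal (lr (r k) x) * indicator ?B x \<partial>white_noise n f0) = ?c"
      by (rule emeasure_box_lr[OF J(1) _ A])
    \<comment> \<open>The estimate is symmetric in the two weights, so it is used once with
      \<open>Z\<close> on the left and once with \<open>lr (r k)\<close> on the left.\<close>
    have le: "(\<integral>\<^sup>+x. ennreal (g x) * indicator ?B x \<partial>white_noise n f0)
        \<le> (\<integral>\<^sup>+x. ennreal (g' x) * indicator ?B x \<partial>white_noise n f0) + ennreal e"
      if [measurable]: "g' \<in> borel_measurable coeff_borel" and "\<And>x. 0 \<le> g' x"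
        and eq: "\<And>x. \<bar>g x - g' x\<bar> = \<bar>lr (r k) x - Z x\<bar>" for g g'
    proof -
      have "(\<integral>\<^sup>+x. ennreal (g x) * indicator ?B x \<partial>white_noise n f0)
        \<le> (\<integral>\<^sup>+x. ennreal (g' x) * indicator ?B x + ennreal \<bar>lr (r k) x - Z x\<bar> \<partial>white_noise n f0)"
        using that(2) unfolding eq[symmetric]
        by (intro nn_integral_mono) (auto simp: indicator_def ennreal_plus[symmetric] intro!: ennreal_leI simp del: ennreal_plus)
      also have "\<dots> = (\<integral>\<^sup>+x. ennreal (g' x) * indicator ?B x \<partial>white_noise n f0)
          + (\<integral>\<^sup>+x. ennreal \<bar>lr (r k) x - Z x\<bar> \<partial>white_noise n f0)"
        by (subst nn_integral_add) auto
      finally show ?thesis using k(2) by (meson add_left_mono order_trans)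
    qed
    show ?thesis
    proof
      show "?a \<le> ?c + ennreal e"
        unfolding box[symmetric]
        by (rule le) (auto simp: abs_minus_commute intro: less_imp_le lr_pos)
      show "?c \<le> ?a + ennreal e"
        unfolding box[symmetric] by (rule le) (auto simp: Z)
    qed
  qed
  show ?thesis
  proof (rule antisym)
    show "?a \<le> ?c" by (rule ennreal_le_epsilon) (use approx in blast)
    show "?c \<le> ?a" by (rule ennreal_le_epsilon) (use approx in blast)
  qed
qed

text \<open>An L1 Cauchy sequence has an almost everywhere convergent subsequence. L1 convergence
  identifies the limit as the density of \<open>white_noise n f\<close>, and Fatou carries the
  moment formulas over as inequalities.\<close>

lemma likelihood_ratio:
  obtains Z where "Z \<in> borel_measurable coeff_borel" "\<And>x. 0 < Z x"
    "white_noise n f = density (white_noise n f0) (\<lambda>x. ennreal (Z x))"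
    "\<And>s. (\<integral>\<^sup>+x. ennreal (Z x powr s) \<partial>white_noise n f0) \<le> ennreal (exp (s * (s - 1) / 2 * total_energy))"
proof -
  interpret P: product_prob_space "\<lambda>i. obs_law n (f i)" wav_idx
    by (intro product_prob_spaceI prob_space_obs_law n)
  obtain r where r: "strict_mono r" and Cauchy: "AE x in white_noise n f0. Cauchy (\<lambda>k. lr (r k) x)"
    using cauchy_L1_AE_cauchy_subseq[OF integrable_lr lr_Cauchy_L1] by blast
  define Z0 where "Z0 x = lim (\<lambda>k. lr (r k) x)" for x
  have Z0_meas [measurable]: "Z0 \<in> borel_measurable coeff_borel"
    unfolding Z0_def[abs_def] by measurable
  have lim: "AE x in white_noise n f0. (\<lambda>k. lr (r k) x) \<longlonglongrightarrow> Z0 x"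
    using Cauchy unfolding Z0_def
    by (auto elim!: eventually_mono simp: convergent_LIMSEQ_iff[symmetric] real_Cauchy_convergent)
  have energy_lim: "(\<lambda>k. energy (r k)) \<longlonglongrightarrow> total_energy"
    using LIMSEQ_subseq_LIMSEQ[OF energy_tendsto r] by (simp add: o_def)
  have moments: "liminf (\<lambda>k. \<integral>\<^sup>+x. ennreal (lr (r k) x powr s) \<partial>white_noise n f0)
      \<le> ennreal (exp (s * (s - 1) / 2 * total_energy))" for s
    unfolding nn_integral_lr_powr
    by (intro eq_refl lim_imp_Liminf tendsto_ennrealI tendsto_intros energy_lim) auto

  \<comment> \<open>The moment of order -1 stays bounded. As the inverse of 0 in
    \<open>ennreal\<close> is infinite, the limit is almost everywhere positive.\<close>
  have "(\<integral>\<^sup>+x. inverse (ennreal (Z0 x)) \<partial>white_noise n f0) \<le> ennreal (exp total_energy)"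
  proof (rule nn_integral_AE_limit_le)
    show "AE x in white_noise n f0. (\<lambda>k. inverse (ennreal (lr (r k) x))) \<longlonglongrightarrow> inverse (ennreal (Z0 x))"
      using lim
    proof eventually_elim
      case (elim x)
      show ?case
        by (rule continuous_on_tendsto_compose[OF continuous_on_inverse_ennreal[OF continuous_on_id]
              tendsto_ennrealI[OF elim], where s = UNIV]) auto
    qed
    have "inverse (ennreal (lr k x)) = ennreal (lr k x powr -1)" for k x
      using lr_pos[of k x] by (simp add: inverse_ennreal powr_minus)
    then show "liminf (\<lambda>k. \<integral>\<^sup>+x. inverse (ennreal (lr (r k) x)) \<partial>white_noise n f0) \<le> ennreal (exp total_energy)"
      using moments[of "-1"] by simp
  qed measurable
  then have "AE x in white_noise n f0. inverse (ennreal (Z0 x)) \<noteq> \<infinity>"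
    by (intro nn_integral_PInf_AE) (auto simp: top_unique)
  then have pos: "AE x in white_noise n f0. 0 < Z0 x"
    by (auto elim!: eventually_mono simp: ennreal_eq_0_iff not_le)

  \<comment> \<open>Changing the limit on a null set makes it positive everywhere, so that powers
    with negative exponents are continuous at each value of \<open>Z\<close>.\<close>
  define Z where "Z x = (if 0 < Z0 x then Z0 x else 1)" for x
  have Z_meas [measurable]: "Z \<in> borel_measurable coeff_borel"
    unfolding Z_def[abs_def] by measurable
  have Z_pos: "0 < Z x" for x by (simp add: Z_def)
  have Z_lim: "AE x in white_noise n f0. (\<lambda>k. lr (r k) x) \<longlonglongrightarrow> Z x"
    using lim pos by eventually_elim (simp add: Z_def)

  have L1: "eventually (\<lambda>k. (\<integral>\<^sup>+x. ennreal \<bar>lr (r k) x - Z x\<bar> \<partial>white_noise n f0) \<le> ennreal e) sequentially"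
    if e: "0 < e" for e
  proof -
    obtain K where K: "\<And>i j. i \<ge> K \<Longrightarrow> j \<ge> K \<Longrightarrow> (\<integral>x. norm (lr i x - lr j x) \<partial>white_noise n f0) < e"
      using lr_Cauchy_L1[OF e] by blast
    have nn: "(\<integral>\<^sup>+x. ennreal \<bar>lr i x - lr j x\<bar> \<partial>white_noise n f0) \<le> ennreal e" if "i \<ge> K" "j \<ge> K" for i j
      using K[OF that]
      by (subst nn_integral_eq_integral) (auto intro!: integrable_lr ennreal_leI)
    show ?thesis
    proof (rule eventually_sequentiallyI[of K])
      fix k assume "K \<le> k"
      then have k: "r k \<ge> K" using seq_suble[OF r, of k] by simp
      show "(\<integral>\<^sup>+x. ennreal \<bar>lr (r k) x - Z x\<bar> \<partial>white_noise n f0) \<le> ennreal e"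
      \<comment> \<open>The second index of the Cauchy estimate goes to infinity, by Fatou.\<close>
      proof (rule nn_integral_AE_limit_le)
        show "AE x in white_noise n f0. (\<lambda>m. ennreal \<bar>lr (r k) x - lr (r m) x\<bar>) \<longlonglongrightarrow> ennreal \<bar>lr (r k) x - Z x\<bar>"
          using Z_lim by eventually_elim (intro tendsto_intros tendsto_ennrealI)
        have "eventually (\<lambda>m. (\<integral>\<^sup>+x. ennreal \<bar>lr (r k) x - lr (r m) x\<bar> \<partial>white_noise n f0) \<le> ennreal e) sequentially"
          using k seq_suble[OF r] by (intro eventually_sequentiallyI[of K] nn) (auto intro: order_trans)
        then show "liminf (\<lambda>m. \<integral>\<^sup>+x. ennreal \<bar>lr (r k) x - lr (r m) x\<bar> \<partial>white_noise n f0) \<le> ennreal e"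
          by (intro order_trans[OF Liminf_le_Limsup Limsup_bounded]) auto
      qed measurable
    qed
  qed

  show thesis
  proof
    show "Z \<in> borel_measurable coeff_borel" by measurable
    show "0 < Z x" for x by (rule Z_pos)
    have "density (white_noise n f0) (\<lambda>x. ennreal (Z x)) = PiM wav_idx (\<lambda>i. obs_law n (f i))"
    proof (rule P.PiM_eq)
      show "sets (density (white_noise n f0) (\<lambda>x. ennreal (Z x))) = sets (PiM wav_idx (\<lambda>i. obs_law n (f i)))"
        by (simp add: sets_white_noise sets_white_noise[of f, unfolded white_noise_def])
      fix J A assume J: "finite J" "J \<subseteq> wav_idx" and A: "\<And>j. j \<in> J \<Longrightarrow> A j \<in> sets (obs_law n (f j))"
      have emb: "prod_emb wav_idx (\<lambda>i. obs_law n (f i)) J (Pi\<^sub>E J A) = prod_emb wav_idx (\<lambda>_. borel) J (Pi\<^sub>E J A)"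
        by (simp add: prod_emb_def space_PiM)
      have "prod_emb wav_idx (\<lambda>_. borel) J (Pi\<^sub>E J A) \<in> sets coeff_borel"
        using J A by (intro sets_PiM_I) auto
      then show "emeasure (density (white_noise n f0) (\<lambda>x. ennreal (Z x)))
          (prod_emb wav_idx (\<lambda>i. obs_law n (f i)) J (Pi\<^sub>E J A)) = (\<Prod>j\<in>J. emeasure (obs_law n (f j)) (A j))"
        unfolding emb using A less_imp_le[OF Z_pos]
        by (subst emeasure_density) (auto simp: sets_white_noise intro!: emeasure_box_limit[OF _ _ r L1 J])
    qed
    then show "white_noise n f = density (white_noise n f0) (\<lambda>x. ennreal (Z x))"
      by (simp add: white_noise_def)
    show "(\<integral>\<^sup>+x. ennreal (Z x powr s) \<partial>white_noise n f0) \<le> ennreal (exp (s * (s - 1) / 2 * total_energy))" for s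
    proof (rule nn_integral_AE_limit_le[OF _ _ moments[of s]])
      show "AE x in white_noise n f0. (\<lambda>k. ennreal (lr (r k) x powr s)) \<longlonglongrightarrow> ennreal (Z x powr s)"
        using Z_lim
      proof eventually_elim
        case (elim x)
        show ?case
          using Z_pos[of x] by (intro tendsto_ennrealI tendsto_powr elim tendsto_const) simp
      qed
    qed measurable
  qed
qed

end

section \<open>From prior mass to contraction\<close>

text \<open>Densities with respect to \<open>\<mu>\<close> are unique almost everywhere, so any
  version \<open>p\<close> satisfies \<open>p f x = p f0 x * Z x\<close> for almost every
  \<open>x\<close>, and the moment bounds of \<open>Z\<close> hold for it.\<close>

lemma likelihood_ratio_moment:
  assumes n: "1 \<le> n" and lik: "is_likelihood n \<mu> p"
    and f0: "f0 \<in> l2_space" "f0 \<in> space coeff_borel" and f: "f \<in> l2_space" "f \<in> space coeff_borel"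
  shows "AE x in white_noise n f0. 0 < p f x"
    and "(\<integral>\<^sup>+x. ennreal ((p f x / p f0 x) powr s) \<partial>white_noise n f0)
      \<le> ennreal (exp (s * (s - 1) / 2 * (real n * infsum (\<lambda>i. (f i - f0 i)\<^sup>2) wav_idx)))"
proof -
  interpret W: white_noise_pair n f f0 by unfold_locales (use n f f0 in auto)
  interpret sigma_finite_measure \<mu> using lik by (simp add: is_likelihood_def)
  have sets_\<mu> [measurable_cong]: "sets \<mu> = sets coeff_borel" using lik by (simp add: is_likelihood_def)
  have pm: "(\<lambda>(f, x). p f x) \<in> borel_measurable (coeff_borel \<Otimes>\<^sub>M coeff_borel)"
    and nonneg: "0 \<le> p g x" for g x
    using lik by (auto simp: is_likelihood_def)
  have meas: "p g \<in> borel_measurable coeff_borel" if "g \<in> space coeff_borel" for g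
    using measurable_compose[OF measurable_Pair1'[OF that] pm] by simp
  note [measurable] = meas[OF f(2)] meas[OF f0(2)]
  obtain Z where Z [measurable]: "Z \<in> borel_measurable coeff_borel" and Z_pos: "\<And>x. 0 < Z x"
    and dens: "white_noise n f = density (white_noise n f0) (\<lambda>x. ennreal (Z x))"
    and moment: "\<And>s. (\<integral>\<^sup>+x. ennreal (Z x powr s) \<partial>white_noise n f0) \<le> ennreal (exp (s * (s - 1) / 2 * W.total_energy))"
    using W.likelihood_ratio by metis
  have wn: "white_noise n g = density \<mu> (\<lambda>x. ennreal (p g x))" if "g \<in> l2_space" for g
    using lik that by (simp add: is_likelihood_def)
  have "density \<mu> (\<lambda>x. ennreal (p f x)) = density \<mu> (\<lambda>x. ennreal (p f0 x) * ennreal (Z x))"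
    using dens unfolding wn[OF f(1)] wn[OF f0(1)] by (subst (asm) density_density_eq) auto
  then have "AE x in \<mu>. ennreal (p f x) = ennreal (p f0 x) * ennreal (Z x)"
    by (subst (asm) density_unique_iff) auto
  then have AE: "AE x in \<mu>. p f x = p f0 x * Z x"
    by eventually_elim (use nonneg Z_pos in \<open>auto simp: ennreal_mult[symmetric] less_imp_le\<close>)
  \<comment> \<open>The zero set of \<open>p f0\<close> is null under
    \<open>white_noise n f0\<close>, hence dividing by \<open>p f0 x\<close> is harmless.\<close>
  then have ratio: "AE x in white_noise n f0. 0 < p f0 x \<and> p f x = p f0 x * Z x"
    unfolding wn[OF f0(1)] by (subst AE_density) (auto elim!: eventually_mono)
  then show "AE x in white_noise n f0. 0 < p f x"
    by eventually_elim (use Z_pos in auto)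
  have "(\<integral>\<^sup>+x. ennreal ((p f x / p f0 x) powr s) \<partial>white_noise n f0)
      = (\<integral>\<^sup>+x. ennreal (Z x powr s) \<partial>white_noise n f0)"
  proof (rule nn_integral_cong_AE)
    show "AE x in white_noise n f0. ennreal ((p f x / p f0 x) powr s) = ennreal (Z x powr s)"
      using ratio by eventually_elim auto
  qed
  then show "(\<integral>\<^sup>+x. ennreal ((p f x / p f0 x) powr s) \<partial>white_noise n f0)
      \<le> ennreal (exp (s * (s - 1) / 2 * (real n * infsum (\<lambda>i. (f i - f0 i)\<^sup>2) wav_idx)))"
    using moment[of s] by (simp add: W.total_energy_def)
qed

text \<open>Cauchy--Schwarz; the inverse in \<^typ>\<open>ennreal\<close> makes it valid where \<open>u\<close> vanishes.\<close>

lemma inverse_nn_integral_le: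
  fixes u :: "'a \<Rightarrow> real"
  assumes [measurable]: "u \<in> borel_measurable M" "E \<in> sets M" and u: "\<And>x. 0 \<le> u x"
    and w: "emeasure M E = ennreal w" "0 < w"
  shows "inverse (\<integral>\<^sup>+x\<in>E. ennreal (u x) \<partial>M) \<le> (\<integral>\<^sup>+x\<in>E. inverse (ennreal (u x)) \<partial>M) * ennreal (1 / w\<^sup>2)"
    (is "inverse ?D \<le> ?V * _")
proof (cases "?V = \<infinity>")
  case True
  then show ?thesis using w(2) by (simp add: ennreal_top_mult)
next
  case False
  let ?f = "\<lambda>x. ennreal (sqrt (u x)) * indicator E x"
  let ?g = "\<lambda>x. inverse (ennreal (sqrt (u x))) * indicator E x"
  have sq: "(ennreal (sqrt (u x)))\<^sup>2 = ennreal (u x)" for x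
    using u by (simp add: ennreal_power)
  \<comment> \<open>Finiteness of the integral of the inverse forces \<open>u\<close> to be positive
    almost everywhere on \<open>E\<close>; otherwise the product of the two Cauchy-Schwarz factors
    would be 0 there instead of 1.\<close>
  have "AE x in M. inverse (ennreal (u x)) * indicator E x \<noteq> \<infinity>"
    using False by (intro nn_integral_PInf_AE) auto
  then have "AE x in M. ?f x * ?g x = indicator E x"
  proof eventually_elim
    case (elim x)
    then have "x \<in> E \<Longrightarrow> 0 < u x" using u[of x] by (auto simp: less_le ennreal_eq_0_iff)
    then show ?case
      by (auto simp: indicator_def inverse_ennreal ennreal_mult[symmetric])
  qed
  then have "(\<integral>\<^sup>+x. ?f x * ?g x \<partial>M) = emeasure M E"
    by (subst nn_integral_cong_AE) auto
  moreover have "(\<integral>\<^sup>+x. (?f x)\<^sup>2 \<partial>M) = ?D"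
    by (intro nn_integral_cong) (auto simp: indicator_def sq power_mult_distrib)
  moreover have "(\<integral>\<^sup>+x. (?g x)\<^sup>2 \<partial>M) = ?V"
    by (intro nn_integral_cong) (auto simp: indicator_def sq power_mult_distrib ennreal_inverse_power[symmetric])
  ultimately have CS: "ennreal (w\<^sup>2) \<le> ?D * ?V"
    using Cauchy_Schwarz_nn_integral[of ?f M ?g] w by (simp add: ennreal_power)
  have "0 < ?D"
    using CS w(2) by (cases "?D = 0") (auto simp: zero_less_iff_neq_zero)
  moreover have "1 \<le> ?D * (?V * ennreal (1 / w\<^sup>2))"
  proof -
    have "1 = ennreal (w\<^sup>2) * ennreal (1 / w\<^sup>2)"
      using w(2) by (simp add: ennreal_mult[symmetric])
    also have "\<dots> \<le> ?D * ?V * ennreal (1 / w\<^sup>2)" by (intro mult_right_mono CS) auto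
    finally show ?thesis by (simp add: mult.assoc)
  qed
  ultimately have "1 / ?D \<le> ?V * ennreal (1 / w\<^sup>2)" by (rule divide_le_posI_ennreal)
  then show ?thesis by (simp add: divide_ennreal_def)
qed

lemma ennreal_divide_cancel_left:
  assumes "0 < k" "k < top"
  shows "(k * a) / (k * b) = a / (b :: ennreal)"
proof -
  have "k * inverse k = 1"
    using assms by (metis divide_ennreal_def ennreal_divide_self less_irrefl)
  moreover have "inverse (k * b) = inverse k * inverse b"
    using assms by (intro ennreal_inverse_mult') auto
  ultimately show ?thesis
    by (simp add: divide_ennreal_def) (metis mult.assoc mult.commute mult_1)
qed

lemma ennreal_inverse_mono: "a \<le> b \<Longrightarrow> inverse b \<le> inverse (a :: ennreal)"
proof (cases "a = 0 \<or> b = top")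
  case False
  assume "a \<le> b"
  with False obtain x y where "a = ennreal x" "b = ennreal y" "0 < x" "x \<le> y"
    by (cases a; cases b) (auto simp: less_le top_unique)
  then show ?thesis by (auto simp: inverse_ennreal intro!: ennreal_leI le_imp_inverse_le)
qed auto

text \<open>A square-root free form of \<open>min 1 (a / b) \<le> sqrt (a / b)\<close>, linear in \<open>a\<close> and \<open>1 / b\<close>.\<close>

lemma ennreal_divide_le_linear:
  fixes a b y :: ennreal
  assumes "a \<le> b" "inverse b \<le> y" "0 < c"
  shows "a / b \<le> ennreal c * a + ennreal (1 / c) * y"
proof (cases "1 \<le> ennreal c * a")
  case True
  have "a / b \<le> 1"
  \<comment> \<open>If \<open>b = 0\<close> then \<open>a = 0\<close> as well, and 0 / 0 is 0 in
    \<open>ennreal\<close>.\<close>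
  proof (cases "b = 0")
    case True with assms show ?thesis by (simp add: divide_ennreal_def)
  next
    case False with assms show ?thesis by (intro divide_le_posI_ennreal) (auto simp: zero_less_iff_neq_zero)
  qed
  with True show ?thesis by (meson add_increasing2 order_trans zero_le)
next
  case False
  have "a = ennreal (1 / c) * (ennreal c * a)"
    using assms(3) by (simp add: mult.assoc[symmetric] ennreal_mult[symmetric])
  also have "\<dots> \<le> ennreal (1 / c) * 1" using False by (intro mult_left_mono) auto
  finally have "a \<le> ennreal (1 / c)" by simp
  then have "a * inverse b \<le> ennreal (1 / c) * y" using assms(2) by (intro mult_mono) auto
  then show ?thesis by (simp add: divide_ennreal_def add_increasing)
qed

text \<open>The summand 1 comes from the numerator, through the moment of order
  \<open>\<rho>\<close>; the other one from the denominator restricted to \<open>E\<close>, through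
  the moment of order \<open>- \<rho>\<close> and the prior mass of \<open>E\<close>. Both carry the
  same exponential factor, because the weight in \<open>ennreal_divide_le_linear\<close> is chosen
  to balance them.\<close>

lemma tempered_posterior_bound:
  fixes prior :: "coeffs measure"
  assumes n: "1 \<le> n" and lik: "is_likelihood n \<mu> p"
    and f0: "f0 \<in> l2_space" "f0 \<in> space coeff_borel"
    and prior: "prob_space prior" "sets prior = sets coeff_borel" and l2: "AE f in prior. f \<in> l2_space"
    and \<rho>: "0 < \<rho>" "\<rho> < 1" and \<tau>: "0 \<le> \<tau>"
    and E: "E \<in> sets coeff_borel" "\<And>f. f \<in> E \<Longrightarrow> f \<in> l2_space"
      "\<And>f. f \<in> E \<Longrightarrow> infsum (\<lambda>i. (f i - f0 i)\<^sup>2) wav_idx \<le> a"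
    and w: "0 < w" "w \<le> measure prior E"
  shows "(\<integral>\<^sup>+X. tempered_posterior \<rho> p prior X {f \<in> space coeff_borel. l2_norm (\<lambda>i. f i - f0 i) > ennreal \<tau>}
      \<partial>white_noise n f0)
    \<le> ennreal (exp (- \<rho> * (1 - \<rho>) * real n * \<tau>\<^sup>2 / 4) * (1 + exp (\<rho> * (1 + \<rho>) * real n * a / 2) / w))"
proof -
  let ?Q = "white_noise n f0"
  let ?F = "{f \<in> space coeff_borel. l2_norm (\<lambda>i. f i - f0 i) > ennreal \<tau>}"
  interpret W: white_noise_pair n f0 f0 by unfold_locales (use n f0 in auto)
  interpret prior: prob_space prior by fact
  interpret Q: prob_space ?Q by (rule W.prob_space_white_noise)
  interpret PQ: pair_sigma_finite prior ?Q by unfold_locales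
  note [measurable_cong] = prior(2) W.sets_white_noise
  note E(1)[measurable]
  have [measurable]: "(\<lambda>(f, x). p f x) \<in> borel_measurable (coeff_borel \<Otimes>\<^sub>M coeff_borel)"
    and nonneg: "0 \<le> p g x" for g x
    using lik by (auto simp: is_likelihood_def)
  have [measurable]: "p f0 \<in> borel_measurable coeff_borel"
    by (rule measurable_compose_Pair1[OF f0(2), of "\<lambda>(f, x). p f x", simplified]) measurable
  have F_eq: "?F = {f \<in> space coeff_borel. \<exists>N. (\<Sum>i\<in>levels N. (f i - f0 i)\<^sup>2) > \<tau>\<^sup>2}"
    using l2_norm_gt_iff[OF \<tau>] by auto
  have F [measurable]: "?F \<in> sets coeff_borel"
  proof -
    note W.component_measurable[measurable]
    show ?thesis unfolding F_eq by measurable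
  qed
  \<comment> \<open>Dividing by \<open>p f0 x\<close> changes numerator and denominator of the
    posterior by the same factor and turns the integrands into powers of likelihood ratios.\<close>
  define u where "u f x = (p f x / p f0 x) powr \<rho>" for f x
  have u_meas [measurable]: "(\<lambda>(f, x). u f x) \<in> borel_measurable (coeff_borel \<Otimes>\<^sub>M coeff_borel)"
    unfolding u_def by measurable
  define N where "N x = (\<integral>\<^sup>+f\<in>?F. ennreal (u f x) \<partial>prior)" for x
  define D where "D x = (\<integral>\<^sup>+f. ennreal (u f x) \<partial>prior)" for x
  define V where "V x = (\<integral>\<^sup>+f\<in>E. inverse (ennreal (u f x)) \<partial>prior)" for x
  \<comment> \<open>Half of the decay exponent of the numerator: with the weight
    \<open>exp \<gamma>\<close> on \<open>N\<close>, whose integral is at most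
    \<open>exp (- 2 * \<gamma>)\<close>, a factor \<open>exp (- \<gamma>)\<close> remains, and
    \<open>V\<close> receives the same factor.\<close>
  define \<gamma> where "\<gamma> = \<rho> * (1 - \<rho>) * real n * \<tau>\<^sup>2 / 4"
  define \<pi> where "\<pi> = measure prior E"
  have \<pi>: "0 < \<pi>" "emeasure prior E = ennreal \<pi>"
    using w by (auto simp: \<pi>_def prior.emeasure_eq_measure)
  have [measurable]: "N \<in> borel_measurable coeff_borel" "V \<in> borel_measurable coeff_borel"
    unfolding N_def[abs_def] V_def[abs_def] by measurable

  have int_N: "(\<integral>\<^sup>+x. N x \<partial>?Q) \<le> ennreal (exp (- 2 * \<gamma>))"
  proof -
    have "(\<integral>\<^sup>+x. N x \<partial>?Q) = (\<integral>\<^sup>+f. (\<integral>\<^sup>+x. ennreal (u f x) * indicator ?F f \<partial>?Q) \<partial>prior)"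
      unfolding N_def by (rule PQ.Fubini') measurable
    also have "\<dots> \<le> (\<integral>\<^sup>+f. ennreal (exp (- 2 * \<gamma>)) \<partial>prior)"
    proof (rule nn_integral_mono_AE)
      \<comment> \<open>The moment bound is available only for square-summable \<open>f\<close>,
        which is almost every draw from the prior.\<close>
      show "AE f in prior. (\<integral>\<^sup>+x. ennreal (u f x) * indicator ?F f \<partial>?Q) \<le> ennreal (exp (- 2 * \<gamma>))"
        using l2 AE_space
      proof eventually_elim
        case (elim f)
        show ?case
        proof (cases "f \<in> ?F")
          case True
          let ?T = "infsum (\<lambda>i. (f i - f0 i)\<^sup>2) wav_idx"
          have l2f: "f \<in> l2_space" and sp: "f \<in> space coeff_borel" using elim True by auto
          have "\<tau> < sqrt ?T"
            using True \<tau> l2_space_diff[OF l2f f0(1)] by (simp add: l2_norm_def ennreal_less_iff)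
          then have "\<tau>\<^sup>2 \<le> (sqrt ?T)\<^sup>2" using \<tau> by (intro power_mono) auto
          moreover have "0 \<le> ?T" by (intro infsum_nonneg) auto
          ultimately have "\<tau>\<^sup>2 \<le> ?T" by simp
          then have "\<rho> * (1 - \<rho>) / 2 * (real n * \<tau>\<^sup>2) \<le> \<rho> * (1 - \<rho>) / 2 * (real n * ?T)"
            using \<rho> by (intro mult_left_mono) auto
          then have "\<rho> * (\<rho> - 1) / 2 * (real n * ?T) \<le> - 2 * \<gamma>"
            by (simp add: \<gamma>_def algebra_simps diff_divide_distrib)
          then show ?thesis
            using likelihood_ratio_moment(2)[OF n lik f0 l2f sp, of \<rho>] True
            by (auto simp: u_def intro: order_trans ennreal_leI)
        qed simp
      qed
    qed
    finally show ?thesis by (simp add: prior.emeasure_space_1)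
  qed

  have int_V: "(\<integral>\<^sup>+x. V x \<partial>?Q) \<le> ennreal (exp (\<rho> * (1 + \<rho>) * real n * a / 2)) * ennreal \<pi>"
  proof -
    have "(\<integral>\<^sup>+x. V x \<partial>?Q) = (\<integral>\<^sup>+f. (\<integral>\<^sup>+x. inverse (ennreal (u f x)) * indicator E f \<partial>?Q) \<partial>prior)"
      unfolding V_def by (rule PQ.Fubini') measurable
    also have "\<dots> \<le> (\<integral>\<^sup>+f. ennreal (exp (\<rho> * (1 + \<rho>) * real n * a / 2)) * indicator E f \<partial>prior)"
    proof (rule nn_integral_mono)
      fix f
      show "(\<integral>\<^sup>+x. inverse (ennreal (u f x)) * indicator E f \<partial>?Q)
        \<le> ennreal (exp (\<rho> * (1 + \<rho>) * real n * a / 2)) * indicator E f"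
      proof (cases "f \<in> E")
        case True
        let ?T = "infsum (\<lambda>i. (f i - f0 i)\<^sup>2) wav_idx"
        have l2f: "f \<in> l2_space" and sp: "f \<in> space coeff_borel"
          using E(2) True sets.sets_into_space[OF E(1)] by auto
        note LR = likelihood_ratio_moment[OF n lik f0 l2f sp] likelihood_ratio_moment[OF n lik f0 f0]
        \<comment> \<open>Both \<open>p f\<close> and \<open>p f0\<close> are almost surely
          positive, so the \<open>ennreal\<close> inverse is the power with exponent
          \<open>- \<rho>\<close>; at a zero the two would differ.\<close>
        have "(\<integral>\<^sup>+x. inverse (ennreal (u f x)) \<partial>?Q) = (\<integral>\<^sup>+x. ennreal ((p f x / p f0 x) powr (- \<rho>)) \<partial>?Q)"
          using LR(1) LR(3) by (intro nn_integral_cong_AE)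
            (auto elim!: eventually_elim2 simp: u_def powr_minus inverse_ennreal)
        also have "\<dots> \<le> ennreal (exp (- \<rho> * (- \<rho> - 1) / 2 * (real n * ?T)))"
          by (rule LR(2))
        also have "\<dots> \<le> ennreal (exp (\<rho> * (1 + \<rho>) * real n * a / 2))"
        proof -
          have "\<rho> * (1 + \<rho>) / 2 * (real n * ?T) \<le> \<rho> * (1 + \<rho>) / 2 * (real n * a)"
            using \<rho> E(3)[OF True] by (intro mult_left_mono) auto
          then show ?thesis by (intro ennreal_leI) (simp add: algebra_simps)
        qed
        finally show ?thesis using True by simp
      qed simp
    qed
    also have "\<dots> = ennreal (exp (\<rho> * (1 + \<rho>) * real n * a / 2)) * ennreal \<pi>"
      using \<pi>(2) by (subst nn_integral_cmult_indicator) auto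
    finally show ?thesis .
  qed

  have post: "tempered_posterior \<rho> p prior x ?F
      \<le> ennreal (exp \<gamma>) * N x + ennreal (1 / exp \<gamma>) * (V x * ennreal (1 / \<pi>\<^sup>2))"
    if x: "x \<in> space ?Q" and pos: "0 < p f0 x" for x
  proof -
    have x': "x \<in> space coeff_borel" using x sets_eq_imp_space_eq[OF W.sets_white_noise] by simp
    have [measurable]: "(\<lambda>f. u f x) \<in> borel_measurable coeff_borel"
      using measurable_compose[OF measurable_Pair2'[OF x'] u_meas] by simp
    define k where "k = ennreal (p f0 x powr \<rho>)"
    have fac: "ennreal (p f x powr \<rho>) = k * ennreal (u f x)" for f
      using pos nonneg by (simp add: k_def u_def powr_divide ennreal_mult[symmetric])
    have "tempered_posterior \<rho> p prior x ?F = (k * N x) / (k * D x)"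
      unfolding tempered_posterior_def N_def D_def fac mult.assoc
      by (intro arg_cong2[where f = "(/)"] nn_integral_cmult) measurable
    also have "\<dots> = N x / D x"
      using pos by (intro ennreal_divide_cancel_left) (auto simp: k_def)
    also have "\<dots> \<le> ennreal (exp \<gamma>) * N x + ennreal (1 / exp \<gamma>) * (V x * ennreal (1 / \<pi>\<^sup>2))"
    proof (rule ennreal_divide_le_linear)
      show "N x \<le> D x" unfolding N_def D_def by (intro nn_integral_mono) (auto simp: indicator_def)
      have "(\<integral>\<^sup>+f\<in>E. ennreal (u f x) \<partial>prior) \<le> D x"
        unfolding D_def by (intro nn_integral_mono) (auto simp: indicator_def)
      then have "inverse (D x) \<le> inverse (\<integral>\<^sup>+f\<in>E. ennreal (u f x) \<partial>prior)"
        by (rule ennreal_inverse_mono)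
      also have "\<dots> \<le> V x * ennreal (1 / \<pi>\<^sup>2)"
        unfolding V_def
      proof (rule inverse_nn_integral_le)
        show "(\<lambda>f. u f x) \<in> borel_measurable prior" by measurable
      qed (use \<pi> in \<open>auto simp: u_def\<close>)
      finally show "inverse (D x) \<le> V x * ennreal (1 / \<pi>\<^sup>2)" .
    qed simp
    finally show ?thesis .
  qed
  have "(\<integral>\<^sup>+X. tempered_posterior \<rho> p prior X ?F \<partial>?Q)
    \<le> (\<integral>\<^sup>+x. ennreal (exp \<gamma>) * N x + ennreal (1 / exp \<gamma>) * (V x * ennreal (1 / \<pi>\<^sup>2)) \<partial>?Q)"
    using likelihood_ratio_moment(1)[OF n lik f0 f0] AE_space
    by (intro nn_integral_mono_AE) (auto elim!: eventually_elim2 intro: post)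
  also have "\<dots> = ennreal (exp \<gamma>) * (\<integral>\<^sup>+x. N x \<partial>?Q) + ennreal (1 / exp \<gamma>) * ((\<integral>\<^sup>+x. V x \<partial>?Q) * ennreal (1 / \<pi>\<^sup>2))"
    by (simp add: nn_integral_add nn_integral_cmult nn_integral_multc)
  also have "\<dots> \<le> ennreal (exp \<gamma>) * ennreal (exp (- 2 * \<gamma>)) +
      ennreal (1 / exp \<gamma>) * ((ennreal (exp (\<rho> * (1 + \<rho>) * real n * a / 2)) * ennreal \<pi>) * ennreal (1 / \<pi>\<^sup>2))"
    by (intro add_mono mult_left_mono mult_right_mono int_N int_V) auto
  also have "\<dots> = ennreal (exp (- \<gamma>) * (1 + exp (\<rho> * (1 + \<rho>) * real n * a / 2) / \<pi>))"
  proof -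
    have e: "exp \<gamma> * exp (- 2 * \<gamma>) = exp (- \<gamma>)" by (simp add: exp_add[symmetric])
    show ?thesis
      using \<pi>(1) by (simp add: ennreal_mult[symmetric] ennreal_plus[symmetric] e del: ennreal_plus)
        (simp add: exp_minus power2_eq_square field_simps, simp add: mult_exp_exp)
  qed
  also have "\<dots> \<le> ennreal (exp (- \<gamma>) * (1 + exp (\<rho> * (1 + \<rho>) * real n * a / 2) / w))"
    using w by (intro ennreal_leI mult_left_mono add_left_mono divide_left_mono) (auto simp: \<pi>_def)
  finally show ?thesis by (simp add: \<gamma>_def mult.assoc)
qed

section \<open>The heavy-tailed prior\<close>

lemma sum_levels: "(\<Sum>i\<in>levels N. g i) = (\<Sum>l<N. \<Sum>k<2 ^ l. g (l, k))"
  unfolding levels_def by (subst sum.Sigma) (auto simp: case_prod_beta)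

text \<open>The \<open>2 ^ l\<close> indices of level \<open>l\<close> together contribute
  \<open>2 ^ l / 4 ^ l\<close>, which is a geometric series in 1/2.\<close>

lemma sum_levels_geometric_le: "(\<Sum>i\<in>levels N. (1 / 4 :: real) ^ fst i) \<le> 2"
proof -
  have "(\<Sum>i\<in>levels N. (1 / 4 :: real) ^ fst i) = (\<Sum>l<N. (1 / 2) ^ l)"
    unfolding sum_levels by (intro sum.cong refl) (simp add: power_mult_distrib[symmetric])
  also have "\<dots> \<le> (\<Sum>l. (1 / 2) ^ l)"
    by (intro sum_le_suminf) (auto intro!: summable_geometric)
  also have "\<dots> = 2" by (subst suminf_geometric) auto
  finally show ?thesis .
qed

lemma sum_levels_geometric_tail_le:
  "(\<Sum>i\<in>{i \<in> levels N. J < fst i}. (1 / 4 :: real) ^ fst i) \<le> (1 / 2) ^ J"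
proof -
  have "(\<Sum>i\<in>{i \<in> levels N. J < fst i}. (1 / 4 :: real) ^ fst i)
    = (\<Sum>l<N. if J < l then (1 / 2) ^ l else 0)"
    unfolding sum.inter_filter[OF finite_levels] sum_levels
    by (intro sum.cong refl) (simp add: power_mult_distrib[symmetric])
  also have "\<dots> = (\<Sum>l\<in>{Suc J..<N}. (1 / 2) ^ l)"
    by (subst sum.inter_filter[symmetric]) (auto intro!: sum.cong)
  also have "\<dots> \<le> (1 / 2) ^ J"
  proof (cases "Suc J \<le> N")
    case True
    define x :: real where "x = 1 / 2"
    have half: "x * y = y / 2" for y by (simp add: x_def)
    \<comment> \<open>Closed form of the geometric sum; the last exponent is \<open>N - 1\<close>,
      whence the factor 2 before \<open>x ^ N\<close>.\<close>
    have "(\<Sum>l\<in>{Suc J..<N}. x ^ l) = x ^ J - 2 * x ^ N"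
      using True by (induction N rule: dec_induct) (simp_all add: half)
    moreover have "0 \<le> x" by (simp add: x_def)
    ultimately have "(\<Sum>l\<in>{Suc J..<N}. x ^ l) \<le> x ^ J" by simp
    then show ?thesis by (simp only: x_def)
  qed simp
  finally show ?thesis .
qed

text \<open>Weierstrass product inequality, the union bound for independent events.\<close>

lemma one_minus_sum_le_prod:
  fixes a :: "'i \<Rightarrow> real"
  assumes "finite I" "\<And>i. i \<in> I \<Longrightarrow> 0 \<le> a i" "\<And>i. i \<in> I \<Longrightarrow> a i \<le> 1"
  shows "1 - (\<Sum>i\<in>I. a i) \<le> (\<Prod>i\<in>I. 1 - a i)"
  using assms
proof (induction I rule: finite_induct)
  case (insert i I)
  have "(\<Prod>i\<in>I. 1 - a i) \<le> 1" using insert by (intro prod_le_1) auto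
  then have "a i * (\<Prod>i\<in>I. 1 - a i) \<le> a i" using insert.prems by (intro mult_left_le) auto
  with insert show ?case by (auto simp: algebra_simps)
qed simp

text \<open>The infinite box is the decreasing intersection of the boxes restricting only
  \<open>J N\<close>, so continuity from above passes a bound uniform in \<open>N\<close> to the
  limit.\<close>

lemma (in product_prob_space) prob_countable_box_ge:
  assumes J: "incseq J" "\<And>N::nat. finite (J N)" "(\<Union>N. J N) = I"
    and A: "\<And>i. i \<in> I \<Longrightarrow> A i \<in> sets (M i)"
    and c: "\<And>N. c \<le> (\<Prod>i\<in>J N. measure (M i) (A i))"
  shows "{x \<in> space (PiM I M). \<forall>i\<in>I. x i \<in> A i} \<in> sets (PiM I M)"
    and "c \<le> measure (PiM I M) {x \<in> space (PiM I M). \<forall>i\<in>I. x i \<in> A i}"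
proof -
  define B where "B N = {x \<in> space (PiM I M). \<forall>i\<in>J N. x i \<in> A i}" for N
  have sub: "J N \<subseteq> I" for N using J by auto
  have B: "B N \<in> sets (PiM I M)" for N
    unfolding B_def
  proof (rule sets.sets_Collect_finite_All[OF _ J(2)])
    fix i assume "i \<in> J N"
    then show "{x \<in> space (PiM I M). x i \<in> A i} \<in> sets (PiM I M)"
      using A sub by (intro sets_Collect_single) auto
  qed
  have eq: "{x \<in> space (PiM I M). \<forall>i\<in>I. x i \<in> A i} = (\<Inter>N. B N)"
    unfolding B_def J(3)[symmetric] by auto
  show "{x \<in> space (PiM I M). \<forall>i\<in>I. x i \<in> A i} \<in> sets (PiM I M)"
    unfolding eq using B by auto
  have "decseq B" unfolding decseq_def B_def using J(1) by (auto simp: incseq_def)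
  then have "(\<lambda>N. measure (PiM I M) (B N)) \<longlonglongrightarrow> measure (PiM I M) (\<Inter>N. B N)"
    using B by (intro P.finite_Lim_measure_decseq) auto
  moreover have "c \<le> measure (PiM I M) (B N)" for N
  proof -
    have "emeasure (PiM I M) (B N) = (\<Prod>i\<in>J N. emeasure (M i) (A i))"
      unfolding B_def using sub A J(2) by (intro emeasure_PiM_Collect) auto
    also have "\<dots> = ennreal (\<Prod>i\<in>J N. measure (M i) (A i))"
      by (simp add: M.emeasure_eq_measure prod_ennreal)
    finally show ?thesis
      using c[of N] by (simp add: P.emeasure_eq_measure prod_nonneg)
  qed
  ultimately show "c \<le> measure (PiM I M) {x \<in> space (PiM I M). \<forall>i\<in>I. x i \<in> A i}"
    unfolding eq by (meson LIMSEQ_le_const)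
qed

text \<open>At most \<open>m\<close> factors are only known to be at least \<open>b\<close>; all the
  others together lose at most one half, by the union bound.\<close>

lemma prod_ge_two_groups:
  fixes q p :: "'i \<Rightarrow> real"
  assumes fin: "finite I" and b: "0 < b" "b \<le> 1" and card: "real (card (I \<inter> S)) \<le> m"
    and S: "\<And>i. i \<in> I \<inter> S \<Longrightarrow> b \<le> q i"
    and nS: "\<And>i. i \<in> I - S \<Longrightarrow> 0 \<le> p i \<and> p i \<le> 1 \<and> 1 - p i \<le> q i"
    and sum: "(\<Sum>i\<in>I - S. p i) \<le> 1 / 2"
  shows "b powr m / 2 \<le> (\<Prod>i\<in>I. q i)"
proof -
  have "b powr m \<le> b powr real (card (I \<inter> S))"
    using b card by (intro powr_mono') auto
  also have "\<dots> = (\<Prod>i\<in>I \<inter> S. b)" using b by (simp add: powr_realpow)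
  also have "\<dots> \<le> (\<Prod>i\<in>I \<inter> S. q i)" using b S by (intro prod_mono) auto
  finally have 1: "b powr m \<le> (\<Prod>i\<in>I \<inter> S. q i)" .
  have "1 / 2 \<le> 1 - (\<Sum>i\<in>I - S. p i)" using sum by simp
  also have "\<dots> \<le> (\<Prod>i\<in>I - S. 1 - p i)" using fin nS by (intro one_minus_sum_le_prod) auto
  also have "\<dots> \<le> (\<Prod>i\<in>I - S. q i)" using nS by (intro prod_mono) auto
  finally have 2: "1 / 2 \<le> (\<Prod>i\<in>I - S. q i)" .
  have "b powr m * (1 / 2) \<le> (\<Prod>i\<in>I \<inter> S. q i) * (\<Prod>i\<in>I - S. q i)"
    using 1 2 by (intro mult_mono) (auto intro: order_trans[OF powr_ge_zero])
  also have "\<dots> = (\<Prod>i\<in>I. q i)"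
    using fin by (subst prod.union_disjoint[symmetric]) (auto simp: Int_Diff_Un Int_Un_distrib)
  finally show ?thesis by simp
qed

section \<open>The law of a standardised coefficient and the prior\<close>

locale heavy_tailed_density =
  fixes h :: "real \<Rightarrow> real" and c1 \<kappa> c2 :: real
  assumes h_meas: "h \<in> borel_measurable borel"
    and h_prob: "(\<integral>\<^sup>+x. ennreal (h x) \<partial>lborel) = 1"
    and h_sym: "\<And>x. h (- x) = h x"
    and h_pos: "\<And>x. 0 < h x"
    and h_decr: "antimono_on {0..} h"
    and c1: "0 < c1" and \<kappa>: "0 \<le> \<kappa>"
    and h_log: "\<And>x. 0 \<le> x \<Longrightarrow> ln (1 / h x) \<le> c1 * (1 + ln (1 + x) powr (1 + \<kappa>))"
    and c2: "0 < c2"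
    and h_tail: "\<And>x. 1 \<le> x \<Longrightarrow> (LBINT u:{x..}. h u) \<le> c2 / x\<^sup>2"
begin

definition H :: "real measure" where
  "H = density lborel (\<lambda>x. ennreal (h x))"

declare h_meas [measurable]

lemma sets_H [measurable_cong, simp]: "sets H = sets borel" by (simp add: H_def)
lemma space_H [simp]: "space H = UNIV" by (simp add: H_def)

sublocale H: prob_space H
  by standard (simp add: H_def emeasure_density h_prob)

sublocale HP: product_prob_space "\<lambda>_. H" wav_idx
  by (intro product_prob_spaceI H.prob_space_axioms)

lemma h_abs: "h x = h \<bar>x\<bar>"
  using h_sym[of x] by (cases "0 \<le> x") auto

lemma h_ge: "exp (- c1 * (1 + ln (1 + x) powr (1 + \<kappa>))) \<le> h x" if "0 \<le> x"
proof -
  have "- ln (h x) \<le> c1 * (1 + ln (1 + x) powr (1 + \<kappa>))"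
    using h_log[OF that] h_pos[of x] by (simp add: ln_div)
  then have "exp (- c1 * (1 + ln (1 + x) powr (1 + \<kappa>))) \<le> exp (ln (h x))" by simp
  then show ?thesis using h_pos by simp
qed

lemma measure_H_tail:
  assumes x: "1 \<le> x"
  shows "measure H {u. x < \<bar>u\<bar>} \<le> 2 * c2 / x\<^sup>2"
proof -
  have int: "integrable lborel h"
    using h_prob h_pos by (intro integrableI_nn_integral_finite[where x = 1]) (auto simp: less_imp_le)
  have "set_integrable lborel {x..} h"
    unfolding set_integrable_def using int by (intro integrable_mult_indicator) auto
  then have upper: "emeasure H {x..} \<le> ennreal (c2 / x\<^sup>2)"
  proof -
    assume si: "set_integrable lborel {x..} h"
    have "emeasure H {x..} = (\<integral>\<^sup>+u. ennreal (indicator {x..} u *\<^sub>R h u) \<partial>lborel)"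
      by (simp add: H_def emeasure_density) (intro nn_integral_cong, auto simp: indicator_def)
    also have "\<dots> = ennreal (LBINT u:{x..}. h u)"
      unfolding set_lebesgue_integral_def using si h_pos
      by (intro nn_integral_eq_integral) (auto simp: set_integrable_def less_imp_le)
    also have "\<dots> \<le> ennreal (c2 / x\<^sup>2)" using h_tail[OF x] by (rule ennreal_leI)
    finally show ?thesis .
  qed
  have lower: "emeasure H {..- x} = emeasure H {x..}"
  proof -
    have "emeasure H {..- x} = (\<integral>\<^sup>+u. ennreal (h u) * indicator {..- x} u \<partial>lborel)"
      by (simp add: H_def emeasure_density)
    also have "\<dots> = (\<integral>\<^sup>+u. ennreal (h (0 + (- 1) * u)) * indicator {..- x} (0 + (- 1) * u) \<partial>lborel)"
      by (subst nn_integral_real_affine[of _ "- 1" 0]) auto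
    also have "\<dots> = emeasure H {x..}"
      by (simp add: H_def emeasure_density h_sym) (intro nn_integral_cong, auto simp: indicator_def)
    finally show ?thesis .
  qed
  have "emeasure H {u. x < \<bar>u\<bar>} \<le> emeasure H ({x..} \<union> {..- x})"
    by (intro emeasure_mono) auto
  also have "\<dots> \<le> emeasure H {x..} + emeasure H {..- x}"
    by (intro emeasure_subadditive) auto
  also have "\<dots> \<le> ennreal (c2 / x\<^sup>2) + ennreal (c2 / x\<^sup>2)"
    unfolding lower by (intro add_mono upper)
  also have "\<dots> = ennreal (2 * c2 / x\<^sup>2)"
    using c2 by (subst ennreal_plus[symmetric]) auto
  finally show ?thesis
    using c2 by (simp add: H.emeasure_eq_measure)
qed

text \<open>Every \<open>u\<close> in the interval has absolute value at most
  \<open>\<bar>a\<bar> + \<delta>\<close>, and \<open>h\<close> decreases in the absolute value; the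
  interval has length \<open>2 * \<delta>\<close>.\<close>

lemma measure_H_interval:
  assumes "0 < \<delta>"
  shows "2 * \<delta> * h (\<bar>a\<bar> + \<delta>) \<le> measure H {a - \<delta>..a + \<delta>}"
proof -
  have "ennreal (2 * \<delta> * h (\<bar>a\<bar> + \<delta>)) = (\<integral>\<^sup>+u. ennreal (h (\<bar>a\<bar> + \<delta>)) * indicator {a - \<delta>..a + \<delta>} u \<partial>lborel)"
    using assms h_pos by (subst nn_integral_cmult_indicator) (auto simp: ennreal_mult[symmetric] less_imp_le mult.commute)
  also have "\<dots> \<le> (\<integral>\<^sup>+u. ennreal (h u) * indicator {a - \<delta>..a + \<delta>} u \<partial>lborel)"
  proof (intro nn_integral_mono)
    fix u
    have "h (\<bar>a\<bar> + \<delta>) \<le> h u" if "u \<in> {a - \<delta>..a + \<delta>}"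
      unfolding h_abs[of u] using that assms
      by (intro monotone_onD[OF h_decr]) auto
    then show "ennreal (h (\<bar>a\<bar> + \<delta>)) * indicator {a - \<delta>..a + \<delta>} u \<le> ennreal (h u) * indicator {a - \<delta>..a + \<delta>} u"
      by (auto simp: indicator_def intro: ennreal_leI)
  qed
  also have "\<dots> = emeasure H {a - \<delta>..a + \<delta>}"
    by (simp add: H_def emeasure_density)
  finally show ?thesis by (simp add: H.emeasure_eq_measure)
qed

definition scale :: "nat \<times> nat \<Rightarrow> real" where
  "scale i = 2 powr (- (real (fst i))\<^sup>2)"

lemma scale_pos: "0 < scale i"
  by (simp add: scale_def)

lemma scale_le_1: "scale i \<le> 1"
  unfolding scale_def using powr_mono[of "- (real (fst i))\<^sup>2" 0 2] by simp

abbreviation prior :: "coeffs measure" where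
  "prior \<equiv> series_prior (\<lambda>l. 2 powr (- (real l)\<^sup>2)) h"

lemma prior_eq: "prior = distr (PiM wav_idx (\<lambda>_. H)) coeff_borel (\<lambda>\<zeta>. \<lambda>i\<in>wav_idx. scale i * \<zeta> i)"
  by (simp add: series_prior_def H_def scale_def)

lemma scaling_measurable [measurable]:
  "(\<lambda>\<zeta>. \<lambda>i\<in>wav_idx. scale i * \<zeta> i) \<in> measurable (PiM wav_idx (\<lambda>_. H)) coeff_borel"
proof (rule measurable_restrict)
  fix i :: "nat \<times> nat" assume "i \<in> wav_idx"
  then have "(\<lambda>\<zeta>. \<zeta> i) \<in> borel_measurable (PiM wav_idx (\<lambda>_. H))"
    using measurable_component_singleton[of i wav_idx "\<lambda>_. H"] by (simp cong: measurable_cong_sets)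
  then show "(\<lambda>\<zeta>. scale i * \<zeta> i) \<in> borel_measurable (PiM wav_idx (\<lambda>_. H))" by simp
qed

lemma sets_prior [measurable_cong]: "sets prior = sets coeff_borel"
  by (simp add: prior_eq)

lemma prob_space_prior: "prob_space prior"
  unfolding prior_eq by (intro HP.P.prob_space_distr scaling_measurable)

lemma prior_box_ge:
  assumes A: "\<And>i. i \<in> wav_idx \<Longrightarrow> A i \<in> sets borel"
    and c: "\<And>N. c \<le> (\<Prod>i\<in>levels N. measure H {u. scale i * u \<in> A i})"
  shows "{f \<in> space coeff_borel. \<forall>i\<in>wav_idx. f i \<in> A i} \<in> sets coeff_borel" (is "?E \<in> _")
    and "c \<le> measure prior {f \<in> space coeff_borel. \<forall>i\<in>wav_idx. f i \<in> A i}"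
proof -
  have "(0, 0) \<in> wav_idx" by (simp add: wav_idx_def)
  then have ne: "wav_idx \<noteq> {}" by blast
  then have "?E = (\<Inter>i\<in>wav_idx. {f \<in> space coeff_borel. f i \<in> A i})"
    by blast
  also have "\<dots> \<in> sets coeff_borel"
    using A ne by (intro sets.countable_INT') (auto intro!: sets_Collect_single)
  finally show E: "?E \<in> sets coeff_borel" .
  have "c \<le> measure (PiM wav_idx (\<lambda>_. H)) {\<zeta> \<in> space (PiM wav_idx (\<lambda>_. H)). \<forall>i\<in>wav_idx. \<zeta> i \<in> {u. scale i * u \<in> A i}}"
  proof (rule HP.prob_countable_box_ge(2)[OF _ finite_levels _ _ c])
    show "incseq levels" using levels_mono by (simp add: incseq_def)
    show "(\<Union>N. levels N) = wav_idx" by (simp add: wav_idx_eq_Union_levels)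
    fix i :: "nat \<times> nat" assume "i \<in> wav_idx"
    then have [measurable]: "A i \<in> sets borel" by (rule A)
    show "{u. scale i * u \<in> A i} \<in> sets H" by simp
  qed
  also have "\<dots> = measure prior ?E"
    unfolding prior_eq using E
    by (subst measure_distr) (auto intro!: arg_cong2[where f = measure] simp: space_PiM)
  finally show "c \<le> measure prior ?E" .
qed

text \<open>Borel-Cantelli: by the tail condition, some standardised coefficient of level
  \<open>l\<close> exceeds \<open>2 ^ l\<close> with probability at most
  \<open>2 * c2 / 2 ^ l\<close>, which is summable. On the remaining levels the scales
  \<open>2 powr (- l^2)\<close> make the draw decay geometrically.\<close>

lemma AE_prior_l2_space: "AE f in prior. f \<in> l2_space"
proof -
  let ?P = "PiM wav_idx (\<lambda>_. H)"
  have comp: "(\<lambda>\<zeta>. \<zeta> i) \<in> borel_measurable ?P" if "i \<in> wav_idx" for i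
    using measurable_component_singleton[of i wav_idx "\<lambda>_. H"] that by (simp cong: measurable_cong_sets)
  define B where "B l k = {\<zeta> \<in> space ?P. \<zeta> (l, k) \<in> {u. 2 ^ l < \<bar>u\<bar>}}" for l k :: nat
  define A where "A l = (\<Union>k<2 ^ l. B l k)" for l :: nat
  have B: "B l k \<in> sets ?P" if "k < 2 ^ l" for l k
    unfolding B_def using that by (intro sets_Collect_single) (auto simp: wav_idx_def)
  have A: "A l \<in> sets ?P" for l unfolding A_def using B by auto
  have "measure ?P (A l) \<le> 2 * c2 * (1 / 2) ^ l" for l
  proof -
    have "measure ?P (A l) \<le> (\<Sum>k<2 ^ l. measure ?P (B l k))"
      unfolding A_def using B by (intro HP.P.finite_measure_subadditive_finite) auto
    also have "\<dots> \<le> (\<Sum>k<2 ^ l :: nat. 2 * c2 / (2 ^ l)\<^sup>2)"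
    proof (rule sum_mono)
      fix k :: nat assume "k \<in> {..<2 ^ l}"
      then have "emeasure ?P (B l k) = emeasure H {u. 2 ^ l < \<bar>u\<bar>}"
        unfolding B_def by (intro HP.emeasure_PiM_Collect_single) (auto simp: wav_idx_def)
      then have "measure ?P (B l k) = measure H {u. 2 ^ l < \<bar>u\<bar>}"
        by (simp add: measure_def)
      also have "\<dots> \<le> 2 * c2 / (2 ^ l)\<^sup>2" by (rule measure_H_tail) simp
      finally show "measure ?P (B l k) \<le> 2 * c2 / (2 ^ l)\<^sup>2" .
    qed
    also have "\<dots> = 2 * c2 * (1 / 2) ^ l"
      by (simp add: power2_eq_square field_simps power_divide)
    finally show ?thesis .
  qed
  then have bound: "norm (measure ?P (A l)) \<le> 2 * c2 * (1 / 2) ^ l" for l by simp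
  have "summable (\<lambda>l. 2 * c2 * (1 / 2) ^ l)"
    by (intro summable_mult summable_geometric) simp
  then have "summable (\<lambda>l. measure ?P (A l))"
    by (rule summable_comparison_test'[OF _ bound])
  then have "AE \<zeta> in ?P. eventually (\<lambda>l. \<zeta> \<in> space ?P - A l) sequentially"
    using A by (intro borel_cantelli_AE1) (auto simp: HP.P.emeasure_eq_measure)
  then have AE: "AE \<zeta> in ?P. (\<lambda>i\<in>wav_idx. scale i * \<zeta> i) \<in> l2_space"
  proof eventually_elim
    case (elim \<zeta>)
    then obtain m where m: "\<And>l. l \<ge> m \<Longrightarrow> \<zeta> \<in> space ?P - A l"
      by (auto simp: eventually_sequentially)
    \<comment> \<open>The offset 2 ensures \<open>l \<ge> 2\<close>, hence
      \<open>l - l^2 \<le> - l\<close>.\<close>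
    have small: "(scale i * \<zeta> i)\<^sup>2 \<le> (1 / 4) ^ fst i" if i: "i \<in> wav_idx" "m + 2 \<le> fst i" for i
    proof -
      obtain l k where [simp]: "i = (l, k)" and k: "k < 2 ^ l" and l: "m \<le> l" "2 \<le> l"
        using i by (cases i) (auto simp: wav_idx_def)
      have "\<bar>\<zeta> i\<bar> \<le> 2 ^ l"
        using m[OF l(1)] k unfolding A_def B_def by force
      then have "\<bar>scale i * \<zeta> i\<bar> \<le> 2 powr (- (real l)\<^sup>2) * 2 ^ l"
        using scale_pos[of i] by (auto simp: abs_mult scale_def intro!: mult_mono)
      also have "\<dots> = 2 powr (real l - (real l)\<^sup>2)"
        by (simp add: powr_diff powr_realpow[symmetric] powr_minus field_simps)
      also have "\<dots> \<le> 2 powr (- real l)"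
        using l(2) by (intro powr_mono) (auto simp: power2_eq_square)
      also have "\<dots> = (1 / 2) ^ l"
        by (simp add: powr_minus powr_realpow power_divide field_simps)
      finally have "\<bar>scale i * \<zeta> i\<bar>\<^sup>2 \<le> ((1 / 2) ^ l)\<^sup>2" by (intro power_mono) auto
      then show ?thesis
        by (simp add: power_mult[symmetric] mult.commute[of l] power_mult power_divide)
    qed
    let ?f = "\<lambda>i\<in>wav_idx. scale i * \<zeta> i"
    have "(\<Sum>i\<in>levels N. (?f i)\<^sup>2) \<le> (\<Sum>i\<in>levels (m + 2). (?f i)\<^sup>2) + 2" for N
    proof -
      have "(\<Sum>i\<in>levels N. (?f i)\<^sup>2)
        \<le> (\<Sum>i\<in>levels N. (if i \<in> levels (m + 2) then (?f i)\<^sup>2 else 0) + (1 / 4) ^ fst i)"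
      proof (rule sum_mono)
        fix i assume "i \<in> levels N"
        then have "i \<in> wav_idx" using levels_subset by blast
        moreover from this have "i \<in> levels (m + 2) \<or> m + 2 \<le> fst i"
          by (auto simp: levels_def wav_idx_def)
        ultimately show "(?f i)\<^sup>2 \<le> (if i \<in> levels (m + 2) then (?f i)\<^sup>2 else 0) + (1 / 4) ^ fst i"
          using small[of i] by auto
      qed
      also have "\<dots> = (\<Sum>i\<in>levels N \<inter> levels (m + 2). (?f i)\<^sup>2) + (\<Sum>i\<in>levels N. (1 / 4) ^ fst i)"
        unfolding sum.distrib sum.inter_restrict[OF finite_levels] ..
      also have "\<dots> \<le> (\<Sum>i\<in>levels (m + 2). (?f i)\<^sup>2) + 2"
        by (intro add_mono sum_mono2 sum_levels_geometric_le) auto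
      finally show ?thesis .
    qed
    then show ?case unfolding l2_space_iff_bounded by blast
  qed
  \<comment> \<open>Restricting the bound \<open>C\<close> to integers leaves only countable
    quantifiers, so the set is measurable.\<close>
  have "{f \<in> space coeff_borel. f \<in> l2_space}
      = {f \<in> space coeff_borel. \<exists>C::nat. \<forall>N. (\<Sum>i\<in>levels N. (f i)\<^sup>2) \<le> real C}"
    unfolding l2_space_iff_bounded by (auto, meson order_trans real_arch_simple)
  also have "\<dots> \<in> sets coeff_borel"
  proof -
    have [measurable]: "(\<lambda>f. \<Sum>i\<in>levels N. (f i)\<^sup>2) \<in> borel_measurable coeff_borel" for N
      using levels_subset by (intro borel_measurable_sum borel_measurable_power measurable_component_singleton) auto
    show ?thesis by measurable
  qed
  finally show ?thesis
    unfolding prior_eq using AE by (subst AE_distr_iff) auto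
qed

end

section \<open>Besov coefficients\<close>

locale besov_coeffs =
  fixes \<beta> L r :: real and f0 :: coeffs
  assumes \<beta>: "0 < \<beta>" and L: "0 < L" and r: "1 \<le> r" "r \<le> 2"
    and \<beta>r: "1 / r - 1 / 2 < \<beta>" and f0: "f0 \<in> besov_ball \<beta> r L"
begin

text \<open>The exponent for which level \<open>l\<close> has Besov weight
  \<open>2 powr (\<gamma> * l)\<close>; it is positive exactly because
  \<open>\<beta> > 1 / r - 1 / 2\<close>.\<close>

definition \<gamma> :: real where "\<gamma> = r * (\<beta> + 1/2 - 1/r)"

definition M :: real where "M = L powr r"

lemma \<gamma>_pos: "0 < \<gamma>"
  unfolding \<gamma>_def using \<beta>r r by (intro mult_pos_pos) auto

lemma \<gamma>_eq: "\<gamma> = r * (2 * \<beta> + 1) / 2 - 1"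
  using r by (simp add: \<gamma>_def field_simps)

lemma M_pos: "0 < M" using L by (simp add: M_def)

lemma weighted_sum_le:
  assumes "finite F" "F \<subseteq> wav_idx"
  shows "(\<Sum>i\<in>F. 2 powr (\<gamma> * real (fst i)) * \<bar>f0 i\<bar> powr r) \<le> M"
proof -
  obtain N where "F \<subseteq> levels N" using assms finite_subset_levels by blast
  then have "(\<Sum>i\<in>F. 2 powr (\<gamma> * real (fst i)) * \<bar>f0 i\<bar> powr r)
      \<le> (\<Sum>i\<in>levels N. 2 powr (\<gamma> * real (fst i)) * \<bar>f0 i\<bar> powr r)"
    by (intro sum_mono2) auto
  also have "\<dots> = (\<Sum>l<N. 2 powr (r * real l * (\<beta> + 1/2 - 1/r)) * (\<Sum>k<2 ^ l. \<bar>f0 (l, k)\<bar> powr r))"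
    unfolding sum_levels sum_distrib_left by (simp add: \<gamma>_def mult_ac)
  also have "\<dots> \<le> (\<Sum>l. 2 powr (r * real l * (\<beta> + 1/2 - 1/r)) * (\<Sum>k<2 ^ l. \<bar>f0 (l, k)\<bar> powr r))"
    using f0 by (intro sum_le_suminf) (auto simp: besov_ball_def intro!: mult_nonneg_nonneg sum_nonneg)
  also have "\<dots> \<le> M" using f0 by (simp add: besov_ball_def M_def)
  finally show ?thesis .
qed

text \<open>A Markov-type bound: on \<open>F\<close> the Besov weights are at least
  \<open>x powr \<gamma>\<close>.\<close>

lemma tail_sum_le:
  assumes F: "finite F" "F \<subseteq> wav_idx" and x: "0 < x" "\<And>i. i \<in> F \<Longrightarrow> x \<le> 2 ^ fst i"
  shows "(\<Sum>i\<in>F. \<bar>f0 i\<bar> powr r) \<le> M * x powr (- \<gamma>)"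
proof -
  have "(\<Sum>i\<in>F. \<bar>f0 i\<bar> powr r) \<le> (\<Sum>i\<in>F. x powr (- \<gamma>) * (2 powr (\<gamma> * real (fst i)) * \<bar>f0 i\<bar> powr r))"
  proof (rule sum_mono)
    fix i assume "i \<in> F"
    have "x powr \<gamma> \<le> (2 ^ fst i) powr \<gamma>"
      using x(2)[OF \<open>i \<in> F\<close>] x(1) \<gamma>_pos by (intro powr_mono2) auto
    also have "(2 ^ fst i) powr \<gamma> = 2 powr (\<gamma> * real (fst i))"
      by (simp add: powr_realpow[symmetric] powr_powr mult.commute)
    finally have "1 \<le> x powr (- \<gamma>) * 2 powr (\<gamma> * real (fst i))"
      using x(1) by (simp add: powr_minus field_simps)
    then show "\<bar>f0 i\<bar> powr r \<le> x powr (- \<gamma>) * (2 powr (\<gamma> * real (fst i)) * \<bar>f0 i\<bar> powr r)"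
      using mult_right_mono[of 1 "x powr (- \<gamma>) * 2 powr (\<gamma> * real (fst i))" "\<bar>f0 i\<bar> powr r"]
      by (simp add: mult.assoc)
  qed
  also have "\<dots> = x powr (- \<gamma>) * (\<Sum>i\<in>F. 2 powr (\<gamma> * real (fst i)) * \<bar>f0 i\<bar> powr r)"
    by (simp add: sum_distrib_left)
  also have "\<dots> \<le> x powr (- \<gamma>) * M"
    by (intro mult_left_mono weighted_sum_le F) auto
  finally show ?thesis by (simp add: mult.commute)
qed

lemma weighted_coeff_le: "2 powr (\<gamma> * real (fst i)) * \<bar>f0 i\<bar> powr r \<le> M" if "i \<in> wav_idx"
  using weighted_sum_le[of "{i}"] that by simp

lemma coeff_le:
  assumes "i \<in> wav_idx"
  shows "\<bar>f0 i\<bar> \<le> L"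
proof (rule ccontr)
  assume "\<not> \<bar>f0 i\<bar> \<le> L"
  then have "M < \<bar>f0 i\<bar> powr r"
    unfolding M_def using L r by (intro powr_less_mono2) auto
  moreover have "1 \<le> 2 powr (\<gamma> * real (fst i))"
    using \<gamma>_pos by (intro ge_one_powr_ge_zero) auto
  ultimately have "M < 2 powr (\<gamma> * real (fst i)) * \<bar>f0 i\<bar> powr r"
    using mult_right_mono[of 1 "2 powr (\<gamma> * real (fst i))" "\<bar>f0 i\<bar> powr r"] by simp
  with weighted_coeff_le[OF assms] show False by simp
qed

text \<open>Interpolation between the sup norm and the \<open>r\<close>-sum, using
  \<open>r \<le> 2\<close>.\<close>

lemma square_le:
  assumes "\<bar>f0 i\<bar> \<le> t"
  shows "(f0 i)\<^sup>2 \<le> t powr (2 - r) * \<bar>f0 i\<bar> powr r"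
proof (cases "f0 i = 0")
  case False
  then have "(f0 i)\<^sup>2 = \<bar>f0 i\<bar> powr (2 - r) * \<bar>f0 i\<bar> powr r"
    by (simp add: powr_add[symmetric])
  also have "\<dots> \<le> t powr (2 - r) * \<bar>f0 i\<bar> powr r"
    using assms r by (intro mult_right_mono powr_mono2) auto
  finally show ?thesis .
qed simp

lemma f0_l2: "f0 \<in> l2_space"
proof -
  have "(\<Sum>i\<in>levels N. (f0 i)\<^sup>2) \<le> L powr (2 - r) * (M * 1 powr (- \<gamma>))" for N
  proof -
    have "(\<Sum>i\<in>levels N. (f0 i)\<^sup>2) \<le> (\<Sum>i\<in>levels N. L powr (2 - r) * \<bar>f0 i\<bar> powr r)"
      using levels_subset by (intro sum_mono square_le coeff_le) auto
    also have "\<dots> \<le> L powr (2 - r) * (M * 1 powr (- \<gamma>))"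
      unfolding sum_distrib_left[symmetric] using levels_subset
      by (intro mult_left_mono tail_sum_le) auto
    finally show ?thesis .
  qed
  then show ?thesis unfolding l2_space_iff_bounded by blast
qed

section \<open>Splitting the coefficients of the truth at sample size \<open>n\<close>\<close>

definition K :: "nat \<Rightarrow> real" where
  "K n = real n powr (1 / (2 * \<beta> + 1))"

definition cutoff :: "nat \<Rightarrow> nat" where
  "cutoff n = nat \<lfloor>log 2 (K n)\<rfloor>"

definition thr :: "nat \<Rightarrow> real" where
  "thr n = real n powr (- 1 / 2)"

definition S :: "nat \<Rightarrow> (nat \<times> nat) set" where
  "S n = {i \<in> wav_idx. fst i \<le> cutoff n \<or> thr n < \<bar>f0 i\<bar>}"

context
  fixes n :: nat
  assumes n: "1 \<le> n"
begin

lemma K_ge_1: "1 \<le> K n"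
  unfolding K_def using n \<beta> by (intro ge_one_powr_ge_zero) auto

lemma K_le: "K n \<le> real n"
  unfolding K_def using powr_mono[of "1 / (2 * \<beta> + 1)" 1 "real n"] n \<beta> by simp

lemma n_eq: "real n = K n powr (2 * \<beta> + 1)"
  unfolding K_def using n \<beta> by (simp add: powr_powr)

lemma thr_pos: "0 < thr n" using n by (simp add: thr_def)

lemma thr_le_1: "thr n \<le> 1"
  unfolding thr_def using powr_mono[of "- 1 / 2" 0 "real n"] n by simp

lemma thr_square: "(thr n)\<^sup>2 = 1 / real n"
  using n by (simp add: thr_def power2_eq_square powr_add[symmetric] powr_minus_divide)

text \<open>The balance that determines \<open>K\<close>: up to the factor \<open>M\<close>, the
  tail bound for the \<open>r\<close>-sum beyond resolution \<open>K n\<close> is that of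
  \<open>K n\<close> coefficients at the noise level \<open>thr n\<close>.\<close>

lemma K_powr: "K n powr (- \<gamma>) = K n * thr n powr r"
proof -
  have "- \<gamma> = 1 + (2 * \<beta> + 1) * (- r / 2)"
    by (simp add: \<gamma>_eq field_simps)
  then have "K n powr (- \<gamma>) = K n powr (1 + (2 * \<beta> + 1) * (- r / 2))"
    by simp
  also have "\<dots> = K n * (K n powr (2 * \<beta> + 1)) powr (- r / 2)"
    unfolding powr_powr powr_add[of _ 1] using K_ge_1 by simp
  also have "\<dots> = K n * thr n powr r"
    unfolding n_eq[symmetric] by (simp add: thr_def powr_powr)
  finally show ?thesis .
qed

lemma cutoff_le: "2 ^ cutoff n \<le> K n" and cutoff_gt: "K n < 2 ^ Suc (cutoff n)"
proof -
  have log: "0 \<le> log 2 (K n)" using K_ge_1 by simp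
  have "2 powr real (cutoff n) \<le> 2 powr (log 2 (K n))"
    using log by (intro powr_mono) (auto simp: cutoff_def)
  then show "2 ^ cutoff n \<le> K n" using K_ge_1 by (simp add: powr_realpow)
  have "2 powr (log 2 (K n)) < 2 powr real (Suc (cutoff n))"
    using log by (intro powr_less_mono) (auto simp: cutoff_def, linarith)
  then show "K n < 2 ^ Suc (cutoff n)" using K_ge_1 by (simp only: powr_realpow) simp
qed

lemma beyond_cutoff: "K n \<le> 2 ^ l" if "cutoff n < l"
proof -
  have "(2::real) ^ Suc (cutoff n) \<le> 2 ^ l" using that by (intro power_increasing) auto
  with cutoff_gt show ?thesis by linarith
qed

lemma tail_sum_le_thr:
  assumes "F \<subseteq> levels N" "\<And>i. i \<in> F \<Longrightarrow> cutoff n < fst i"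
  shows "(\<Sum>i\<in>F. \<bar>f0 i\<bar> powr r) \<le> M * (K n * thr n powr r)"
  unfolding K_powr[symmetric] using assms K_ge_1 beyond_cutoff levels_subset finite_subset[OF assms(1)]
  by (intro tail_sum_le) (auto, blast)

text \<open>The levels up to the cutoff hold fewer than \<open>2 * K n\<close> indices; beyond it,
  Markov's inequality for the \<open>r\<close>-sum allows at most \<open>M * K n\<close>
  coefficients above \<open>thr n\<close>.\<close>

lemma card_S_le: "real (card (levels N \<inter> S n)) \<le> (2 + M) * K n"
proof -
  define G where "G = {i \<in> levels N. cutoff n < fst i \<and> thr n < \<bar>f0 i\<bar>}"
  have fin: "finite G" by (simp add: G_def)
  have "real (card G) * thr n powr r = (\<Sum>i\<in>G. thr n powr r)" by simp
  also have "\<dots> \<le> (\<Sum>i\<in>G. \<bar>f0 i\<bar> powr r)"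
    using thr_pos r by (intro sum_mono powr_mono2) (auto simp: G_def)
  also have "\<dots> \<le> M * (K n * thr n powr r)"
    by (rule tail_sum_le_thr[of _ N]) (auto simp: G_def)
  finally have "real (card G) \<le> M * K n"
    using thr_pos by (simp add: mult.assoc[symmetric])
  moreover have "real (card (levels (Suc (cutoff n)))) \<le> 2 * K n"
  proof -
    have "real (card (levels (Suc (cutoff n)))) = (\<Sum>l<Suc (cutoff n). 2 ^ l)"
      using sum_levels[of "\<lambda>_. 1::real" "Suc (cutoff n)"] by simp
    also have "\<dots> = 2 ^ Suc (cutoff n) - 1" by (subst geometric_sum) auto
    finally show ?thesis using cutoff_le by simp
  qed
  moreover have "card (levels N \<inter> S n) \<le> card (levels (Suc (cutoff n)) \<union> G)"
    using fin by (intro card_mono) (auto simp: G_def S_def levels_def wav_idx_def)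
  moreover have "card (levels (Suc (cutoff n)) \<union> G) \<le> card (levels (Suc (cutoff n))) + card G"
    by (rule card_Un_le)
  ultimately show ?thesis by (simp add: algebra_simps)
qed

text \<open>Interpolation at height \<open>thr n\<close> turns the tail bound
  \<open>M * (K n * thr n powr r)\<close> into \<open>M * K n * (thr n)^2\<close>.\<close>

lemma small_coeffs_le: "(\<Sum>i\<in>levels N - S n. (f0 i)\<^sup>2) \<le> M * K n / real n"
proof -
  have notS: "\<bar>f0 i\<bar> \<le> thr n \<and> cutoff n < fst i" if "i \<in> levels N - S n" for i
    using that levels_subset by (auto simp: S_def)
  have "(\<Sum>i\<in>levels N - S n. (f0 i)\<^sup>2) \<le> (\<Sum>i\<in>levels N - S n. thr n powr (2 - r) * \<bar>f0 i\<bar> powr r)"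
    using notS by (intro sum_mono square_le) auto
  also have "\<dots> \<le> thr n powr (2 - r) * (M * (K n * thr n powr r))"
    unfolding sum_distrib_left[symmetric] using notS
    by (intro mult_left_mono tail_sum_le_thr[of _ N]) auto
  also have "\<dots> = M * K n * (thr n powr (2 - r) * thr n powr r)" by simp
  also have "thr n powr (2 - r) * thr n powr r = 1 / real n"
    using thr_pos thr_square by (simp add: powr_add[symmetric])
  finally show ?thesis by simp
qed

text \<open>The first summand accounts for levels up to the cutoff, the second for large
  coefficients beyond it.\<close>

definition \<Lambda> :: real where
  "\<Lambda> = 1 / ln 2 + (\<bar>ln M\<bar> + r / 2) / (\<gamma> * ln 2)"

text \<open>Up to the cutoff, \<open>2 ^ l \<le> K n \<le> n\<close>. A coefficient above
  \<open>thr n\<close> forces \<open>2 powr (\<gamma> * l) * n powr (- r / 2) \<le> M\<close>, which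
  bounds \<open>l\<close> logarithmically since \<open>\<gamma> > 0\<close>; the constant
  \<open>ln M\<close> is absorbed using \<open>ln n \<ge> 1\<close>.\<close>

lemma level_S_le:
  assumes i: "i \<in> S n" and ln: "1 \<le> ln (real n)"
  shows "real (fst i) \<le> \<Lambda> * ln (real n)"
proof -
  have pos: "0 \<le> (\<bar>ln M\<bar> + r / 2) / (\<gamma> * ln 2) * ln (real n)" "0 \<le> 1 / ln 2 * ln (real n)"
    using \<gamma>_pos r ln by auto
  consider "fst i \<le> cutoff n" | "i \<in> wav_idx" "thr n < \<bar>f0 i\<bar>" using i by (auto simp: S_def)
  then show ?thesis
  proof cases
    case 1
    have "(2::real) ^ fst i \<le> 2 ^ cutoff n" using 1 by (intro power_increasing) auto
    also have "\<dots> \<le> real n" using cutoff_le K_le by (rule order_trans)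
    finally have "ln (2 ^ fst i :: real) \<le> ln (real n)" using n by (subst ln_le_cancel_iff) auto
    then have "real (fst i) \<le> 1 / ln 2 * ln (real n)"
      by (simp add: ln_realpow field_simps)
    then show ?thesis using pos unfolding \<Lambda>_def distrib_right by linarith
  next
    case 2
    have "2 powr (\<gamma> * real (fst i)) * thr n powr r \<le> 2 powr (\<gamma> * real (fst i)) * \<bar>f0 i\<bar> powr r"
      using 2 thr_pos r by (intro mult_left_mono powr_mono2) auto
    also have "\<dots> \<le> M" by (rule weighted_coeff_le[OF 2(1)])
    finally have "ln (2 powr (\<gamma> * real (fst i)) * thr n powr r) \<le> ln M"
      using M_pos thr_pos by (subst ln_le_cancel_iff) auto
    then have "\<gamma> * real (fst i) * ln 2 - r / 2 * ln (real n) \<le> ln M"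
      using n thr_pos by (simp add: ln_mult ln_powr thr_def)
    also have "ln M \<le> \<bar>ln M\<bar> * ln (real n)"
      using mult_left_mono[OF ln, of "\<bar>ln M\<bar>"] by simp
    finally have "real (fst i) * (\<gamma> * ln 2) \<le> (\<bar>ln M\<bar> + r / 2) * ln (real n)"
      by (simp add: algebra_simps)
    then have "real (fst i) \<le> (\<bar>ln M\<bar> + r / 2) / (\<gamma> * ln 2) * ln (real n)"
      using \<gamma>_pos by (simp add: field_simps)
    then show ?thesis using pos unfolding \<Lambda>_def distrib_right by linarith
  qed
qed

text \<open>Off \<open>S n\<close> the box is centred at 0, where the prior concentrates, instead of
  at \<open>f0 i\<close>. Its half-width shrinks like \<open>2 powr (- l)\<close>, so the squares
  over all infinitely many indices sum to at most \<open>2 * (thr n)^2\<close>.\<close>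

definition box :: "nat \<times> nat \<Rightarrow> real set" where
  "box i = (if i \<in> S n then {f0 i - thr n..f0 i + thr n}
    else {- ((1 / 2) ^ fst i * thr n)..(1 / 2) ^ fst i * thr n})"

text \<open>In units of \<open>1 / n\<close>, the set \<open>S n\<close> contributes
  \<open>(2 + M) * K n\<close>, the neglected coefficients of \<open>f0\<close> contribute
  \<open>2 * M * K n\<close>, and the widths off \<open>S n\<close> contribute 4, which is at most
  \<open>4 * K n\<close>.\<close>

lemma box_distance:
  assumes f: "\<And>i. i \<in> wav_idx \<Longrightarrow> f i \<in> box i"
  shows "(\<Sum>i\<in>levels N. (f i - f0 i)\<^sup>2) \<le> (6 + 3 * M) * K n / real n"
proof -
  have "(\<Sum>i\<in>levels N. (f i - f0 i)\<^sup>2)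
    \<le> (\<Sum>i\<in>levels N. (if i \<in> S n then (thr n)\<^sup>2 else 0) + (if i \<in> S n then 0 else 2 * (f0 i)\<^sup>2)
        + 2 * (thr n)\<^sup>2 * (1 / 4) ^ fst i)"
  proof (rule sum_mono)
    fix i assume "i \<in> levels N"
    then have fi: "f i \<in> box i" using f levels_subset by blast
    show "(f i - f0 i)\<^sup>2 \<le> (if i \<in> S n then (thr n)\<^sup>2 else 0) + (if i \<in> S n then 0 else 2 * (f0 i)\<^sup>2)
        + 2 * (thr n)\<^sup>2 * (1 / 4) ^ fst i"
    proof (cases "i \<in> S n")
      case True
      then have "\<bar>f i - f0 i\<bar> \<le> thr n" using fi by (auto simp: box_def abs_le_iff)
      then have "(f i - f0 i)\<^sup>2 \<le> (thr n)\<^sup>2" by (rule abs_le_square_iff[THEN iffD1, OF order_trans]) simp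
      with True show ?thesis by (simp add: add_increasing2)
    next
      case False
      then have "\<bar>f i\<bar> \<le> (1 / 2) ^ fst i * thr n" using fi by (auto simp: box_def abs_le_iff)
      then have "(f i)\<^sup>2 \<le> ((1 / 2) ^ fst i * thr n)\<^sup>2" by (rule power2_le_iff_abs_le[THEN iffD2, rotated]) (use thr_pos in auto)
      also have "\<dots> = (thr n)\<^sup>2 * (1 / 4) ^ fst i"
        by (simp add: power_mult_distrib power2_eq_square power_divide flip: power_mult_distrib)
      finally have "(f i)\<^sup>2 \<le> (thr n)\<^sup>2 * (1 / 4) ^ fst i" .
      moreover have "(f i - f0 i)\<^sup>2 \<le> 2 * (f i)\<^sup>2 + 2 * (f0 i)\<^sup>2"
        using zero_le_power2[of "f i + f0 i"] by (simp add: power2_eq_square algebra_simps)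
      ultimately show ?thesis using False by simp
    qed
  qed
  also have "\<dots> = real (card (levels N \<inter> S n)) * (thr n)\<^sup>2 + 2 * (\<Sum>i\<in>levels N - S n. (f0 i)\<^sup>2)
      + 2 * (thr n)\<^sup>2 * (\<Sum>i\<in>levels N. (1 / 4) ^ fst i)"
  proof -
    have "(\<Sum>i\<in>levels N. if i \<in> S n then (thr n)\<^sup>2 else 0) = real (card (levels N \<inter> S n)) * (thr n)\<^sup>2"
      by (subst sum.inter_restrict[symmetric]) auto
    moreover have "(\<Sum>i\<in>levels N. if i \<in> S n then 0 else 2 * (f0 i)\<^sup>2) = 2 * (\<Sum>i\<in>levels N - S n. (f0 i)\<^sup>2)"
      unfolding sum_distrib_left by (intro sum.mono_neutral_cong_right) auto
    ultimately show ?thesis by (simp only: sum.distrib sum_distrib_left[symmetric])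
  qed
  also have "\<dots> \<le> (2 + M) * K n * (thr n)\<^sup>2 + 2 * (M * K n / real n) + 2 * (thr n)\<^sup>2 * 2"
    by (intro add_mono mult_left_mono mult_right_mono card_S_le small_coeffs_le sum_levels_geometric_le) auto
  also have "\<dots> = ((2 + M) * K n + 2 * M * K n + 4) / real n"
    by (simp add: thr_square add_divide_distrib)
  also have "\<dots> \<le> (6 + 3 * M) * K n / real n"
    using K_ge_1 by (intro divide_right_mono) (auto simp: algebra_simps)
  finally show ?thesis .
qed

end

end

section \<open>Prior mass near the truth\<close>

locale heavy_tailed_prior = heavy_tailed_density h c1 \<kappa> c2 + besov_coeffs \<beta> L r f0
  for h :: "real \<Rightarrow> real" and c1 \<kappa> c2 \<beta> L r :: real and f0 :: coeffs
begin

text \<open>The order of the negative log-probability of hitting one coefficient in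
  \<open>S n\<close>.\<close>

definition LL :: "nat \<Rightarrow> real" where
  "LL n = ln (real n) powr (2 + 2 * \<kappa>)"

definition C_ln :: real where
  "C_ln = ln (L + 2) + \<Lambda>\<^sup>2"

text \<open>The 1/2 pays for the interval length \<open>thr n = exp (- ln n / 2)\<close>, the rest
  for the lower bound on \<open>h\<close>, where \<open>C_ln * (ln n)^2\<close> bounds the logarithm
  of the rescaled argument.\<close>

definition C_coeff :: real where
  "C_coeff = 1 / 2 + c1 + c1 * C_ln powr (1 + \<kappa>)"

lemma C_ln_nonneg: "0 \<le> C_ln"
  using L by (simp add: C_ln_def ln_ge_zero)

lemma C_coeff_pos: "0 < C_coeff"
  unfolding C_coeff_def using c1 by (intro add_pos_nonneg) auto

context
  fixes n :: nat
  assumes n3: "3 \<le> n"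
begin

lemma n1: "1 \<le> n" using n3 by simp

lemma ln_ge_1: "1 \<le> ln (real n)"
proof -
  have "exp 1 \<le> real n" using exp_le n3 by linarith
  then have "ln (exp 1) \<le> ln (real n)" using n3 by (subst ln_le_cancel_iff) auto
  then show ?thesis by simp
qed

lemma LL_ge: "ln (real n) \<le> LL n" "1 \<le> LL n"
proof -
  show "ln (real n) \<le> LL n"
    unfolding LL_def using powr_mono[of 1 "2 + 2 * \<kappa>" "ln (real n)"] ln_ge_1 \<kappa> by simp
  then show "1 \<le> LL n" using ln_ge_1 by linarith
qed

text \<open>After division by the scale, the target interval reaches out to \<open>x\<close>, of
  order at most \<open>2 powr (l^2)\<close>. Since \<open>l\<close> is \<open>O(ln n)\<close> on
  \<open>S n\<close>, \<open>ln (1 + x)\<close> is \<open>O((ln n)^2)\<close>, and the log-tail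
  condition raises this to the power \<open>1 + \<kappa>\<close>.\<close>

lemma core_prob:
  assumes i: "i \<in> S n"
  shows "exp (- C_coeff * LL n) \<le> measure H {u. scale i * u \<in> box n i}"
proof -
  let ?s = "scale i" and ?t = "thr n"
  have s: "0 < ?s" by (rule scale_pos)
  define x where "x = \<bar>f0 i / ?s\<bar> + ?t / ?s"
  have t: "0 < ?t" "?t \<le> 1" using thr_pos[OF n1] thr_le_1[OF n1] by auto
  have x: "0 \<le> x" using t s by (simp add: x_def less_imp_le)
  have wav: "i \<in> wav_idx" using i by (simp add: S_def)
  have "1 + x \<le> (L + 2) / ?s"
  proof -
    have "x = (\<bar>f0 i\<bar> + ?t) / ?s" by (simp add: x_def abs_divide add_divide_distrib abs_of_pos[OF scale_pos])
    then have "1 + x = (?s + \<bar>f0 i\<bar> + ?t) / ?s"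
      by (simp add: add_divide_distrib less_imp_neq[OF scale_pos, symmetric])
    also have "\<dots> \<le> (L + 2) / ?s"
      using scale_le_1[of i] coeff_le[OF wav] t s by (intro divide_right_mono) auto
    finally show ?thesis .
  qed
  then have "ln (1 + x) \<le> ln ((L + 2) / ?s)" using x L s by (subst ln_le_cancel_iff) auto
  also have "\<dots> = ln (L + 2) + (real (fst i))\<^sup>2 * ln 2"
    using L by (simp add: ln_div scale_def ln_powr)
  also have "\<dots> \<le> ln (L + 2) * (ln (real n))\<^sup>2 + \<Lambda>\<^sup>2 * (ln (real n))\<^sup>2"
  proof (rule add_mono)
    have "1 \<le> (ln (real n))\<^sup>2" using ln_ge_1 by (simp add: one_le_power)
    then show "ln (L + 2) \<le> ln (L + 2) * (ln (real n))\<^sup>2"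
      using mult_left_mono[of 1 "(ln (real n))\<^sup>2" "ln (L + 2)"] L by simp
    have "(real (fst i))\<^sup>2 * ln 2 \<le> (real (fst i))\<^sup>2 * 1"
      using ln_2_less_1 by (intro mult_left_mono) auto
    also have "\<dots> \<le> (\<Lambda> * ln (real n))\<^sup>2"
      using level_S_le[OF n1 i ln_ge_1] by (simp add: power_mono)
    finally show "(real (fst i))\<^sup>2 * ln 2 \<le> \<Lambda>\<^sup>2 * (ln (real n))\<^sup>2" by (simp add: power_mult_distrib)
  qed
  also have "\<dots> = C_ln * (ln (real n))\<^sup>2" by (simp add: C_ln_def algebra_simps)
  finally have "ln (1 + x) powr (1 + \<kappa>) \<le> (C_ln * (ln (real n))\<^sup>2) powr (1 + \<kappa>)"
    using x \<kappa> by (intro powr_mono2) auto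
  also have "\<dots> = C_ln powr (1 + \<kappa>) * ((ln (real n)) powr 2) powr (1 + \<kappa>)"
    using C_ln_nonneg ln_ge_1 by (simp add: powr_mult)
  also have "\<dots> = C_ln powr (1 + \<kappa>) * LL n"
    by (simp add: powr_powr LL_def distrib_left)
  finally have "c1 * (1 + ln (1 + x) powr (1 + \<kappa>)) \<le> c1 * (1 + C_ln powr (1 + \<kappa>) * LL n)"
    using c1 by (intro mult_left_mono add_left_mono) auto
  moreover have "c1 \<le> c1 * LL n" using mult_left_mono[OF LL_ge(2), of c1] c1 by simp
  ultimately have "- C_coeff * LL n \<le> - (1 / 2) * ln (real n) + (- c1 * (1 + ln (1 + x) powr (1 + \<kappa>)))"
    using LL_ge(1) by (simp add: C_coeff_def algebra_simps)
  then have "exp (- C_coeff * LL n) \<le> exp (- (1 / 2) * ln (real n) + (- c1 * (1 + ln (1 + x) powr (1 + \<kappa>))))"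
    by simp
  also have "\<dots> = ?t * exp (- c1 * (1 + ln (1 + x) powr (1 + \<kappa>)))"
  proof -
    have "?t = exp (- (1 / 2) * ln (real n))" using n3 by (simp add: thr_def powr_def)
    then show ?thesis by (simp only: exp_add)
  qed
  also have "\<dots> \<le> (2 * (?t / ?s)) * h x"
  proof (intro mult_mono h_ge x)
    \<comment> \<open>The scale is at most 1, so rescaling only lengthens the interval.\<close>
    have "?t * ?s \<le> ?t * 1" using scale_le_1[of i] t by (intro mult_left_mono) auto
    then have "?t \<le> ?t / ?s" using s by (simp add: field_simps)
    moreover have "0 \<le> ?t / ?s" using t s by simp
    ultimately show "?t \<le> 2 * (?t / ?s)" by linarith
  qed (use t s in auto)
  also have "\<dots> \<le> measure H {f0 i / ?s - ?t / ?s..f0 i / ?s + ?t / ?s}"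
    unfolding x_def using t s by (intro measure_H_interval) auto
  also have "{f0 i / ?s - ?t / ?s..f0 i / ?s + ?t / ?s} = {u. ?s * u \<in> box n i}"
    using i by (auto simp: box_def[OF n1] diff_divide_distrib[symmetric] add_divide_distrib[symmetric]
        pos_divide_le_eq[OF s] pos_le_divide_eq[OF s] mult.commute)
  finally show ?thesis .
qed

text \<open>In standardised units the half-width is \<open>2 powr (l^2 - l) * thr n\<close>. Beyond
  the cutoff \<open>2 ^ l \<ge> K n\<close>, so \<open>thr n\<close> is at least a fixed power of
  \<open>2 powr (- l)\<close>, and the quadratic exponent pushes the half-width above
  \<open>2 ^ l\<close>; the tail condition then applies.\<close>

lemma tail_prob:
  assumes i: "i \<in> wav_idx" "i \<notin> S n" and cut: "\<beta> + 5 / 2 \<le> real (cutoff n)"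
  shows "1 - 2 * c2 * (1 / 4) ^ fst i \<le> measure H {u. scale i * u \<in> box n i}"
proof -
  let ?s = "scale i" and ?t = "thr n" and ?l = "real (fst i)"
  define x where "x = (1 / 2) ^ fst i * ?t / ?s"
  have l: "cutoff n < fst i" using i by (simp add: S_def)
  have "2 powr (2 * ?l - ?l\<^sup>2) \<le> ?t"
  proof -
    \<comment> \<open>This is the inequality
      \<open>2 * l - l^2 \<le> - l * (2 * \<beta> + 1) / 2\<close> rearranged, which explains the
      condition on the cutoff.\<close>
    have "0 \<le> ?l * (?l - \<beta> - 5 / 2)" using l cut by (intro mult_nonneg_nonneg) auto
    then have "2 powr (2 * ?l - ?l\<^sup>2) \<le> 2 powr (?l * (- (2 * \<beta> + 1) / 2))"
      by (intro powr_mono) (auto simp: power2_eq_square algebra_simps)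
    also have "\<dots> = (2 ^ fst i) powr (- (2 * \<beta> + 1) / 2)"
      by (simp add: powr_realpow[symmetric] powr_powr)
    also have "\<dots> \<le> K n powr (- (2 * \<beta> + 1) / 2)"
      using beyond_cutoff[OF n1 l] K_ge_1[OF n1] \<beta> by (intro powr_mono2') auto
    also have "\<dots> = (K n powr (2 * \<beta> + 1)) powr (- 1 / 2)"
      unfolding powr_powr by (intro arg_cong2[where f = "(powr)"]) (auto simp: field_simps)
    also have "\<dots> = ?t" unfolding n_eq[OF n1, symmetric] thr_def ..
    finally show ?thesis .
  qed
  then have "2 powr (- ?l) * 2 powr (2 * ?l - ?l\<^sup>2) * 2 powr (?l\<^sup>2) \<le> 2 powr (- ?l) * ?t * 2 powr (?l\<^sup>2)"
    by (intro mult_left_mono mult_right_mono) auto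
  also have "2 powr (- ?l) * 2 powr (2 * ?l - ?l\<^sup>2) * 2 powr (?l\<^sup>2) = (2::real) ^ fst i"
    by (simp add: powr_add[symmetric] powr_realpow)
  also have "2 powr (- ?l) * ?t * 2 powr (?l\<^sup>2) = x"
    by (simp add: x_def scale_def powr_minus powr_realpow field_simps power_divide)
  finally have x: "2 ^ fst i \<le> x" .
  have x1: "1 \<le> x" using x order_trans[OF one_le_power[of "2::real"]] by auto
  have "measure H {u. x < \<bar>u\<bar>} \<le> 2 * c2 / x\<^sup>2" by (rule measure_H_tail[OF x1])
  also have "\<dots> \<le> 2 * c2 / (2 ^ fst i)\<^sup>2"
    using x c2 x1 by (intro divide_left_mono power_mono mult_pos_pos) auto
  also have "\<dots> = 2 * c2 * (1 / 4) ^ fst i"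
    by (simp add: power_divide power2_eq_square flip: power_mult_distrib)
  finally have "1 - 2 * c2 * (1 / 4) ^ fst i \<le> 1 - measure H {u. x < \<bar>u\<bar>}" by simp
  also have "\<dots> = measure H (space H - {u. x < \<bar>u\<bar>})"
    by (subst H.prob_compl) auto
  also have "space H - {u. x < \<bar>u\<bar>} = {u. ?s * u \<in> box n i}"
  proof -
    define y where "y = (1 / 2) ^ fst i * ?t"
    have "\<not> x < \<bar>u\<bar> \<longleftrightarrow> \<bar>?s * u\<bar> \<le> y" for u
      unfolding x_def y_def[symmetric]
      by (simp add: not_less pos_le_divide_eq[OF scale_pos] abs_mult abs_of_pos[OF scale_pos] mult.commute)
    then have "\<not> x < \<bar>u\<bar> \<longleftrightarrow> ?s * u \<in> {- y..y}" for u
      unfolding abs_le_iff by (simp add: minus_le_iff conj_commute)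
    moreover have "box n i = {- y..y}" using i by (simp add: box_def[OF n1] y_def)
    ultimately show ?thesis by (intro set_eqI) (simp only: Diff_iff space_H UNIV_I mem_Collect_eq simp_thms)
  qed
  finally show ?thesis .
qed

text \<open>The two groups are \<open>S n\<close>, with at most \<open>(2 + M) * K n\<close> factors
  bounded by \<open>core_prob\<close>, and its complement, where \<open>tail_prob\<close> and the
  union bound leave at least one half.\<close>

lemma prior_mass:
  assumes cut: "\<beta> + 5 / 2 \<le> real (cutoff n)" "4 * c2 \<le> 2 ^ cutoff n"
  defines "E \<equiv> {f \<in> space coeff_borel. \<forall>i\<in>wav_idx. f i \<in> box n i}"
  shows "E \<in> sets coeff_borel"
    and "exp (- C_coeff * (2 + M) * (K n * LL n)) / 2 \<le> measure prior E"
    and "\<And>f. f \<in> E \<Longrightarrow> f \<in> l2_space"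
    and "\<And>f. f \<in> E \<Longrightarrow> infsum (\<lambda>i. (f i - f0 i)\<^sup>2) wav_idx \<le> (6 + 3 * M) * K n / real n"
proof -
  let ?c = "exp (- C_coeff * LL n) powr ((2 + M) * K n) / 2"
  have meas: "box n i \<in> sets borel" for i by (simp add: box_def[OF n1])
  have c: "?c \<le> (\<Prod>i\<in>levels N. measure H {u. scale i * u \<in> box n i})" for N
  proof (rule prod_ge_two_groups[where S = "S n" and p = "\<lambda>i. 2 * c2 * (1 / 4) ^ fst i"])
    show "exp (- C_coeff * LL n) \<le> 1" using C_coeff_pos LL_ge by (auto intro!: mult_nonneg_nonneg)
    show "real (card (levels N \<inter> S n)) \<le> (2 + M) * K n" by (rule card_S_le[OF n1])
    show "exp (- C_coeff * LL n) \<le> measure H {u. scale i * u \<in> box n i}" if "i \<in> levels N \<inter> S n" for i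
      using that by (intro core_prob) auto
    \<comment> \<open>The failure probabilities beyond the cutoff sum to at most this quantity,
      which is why \<open>4 * c2 \<le> 2 ^ cutoff n\<close> is required.\<close>
    have half: "2 * c2 * (1 / 2) ^ cutoff n \<le> 1 / 2"
      using cut(2) by (simp add: power_divide field_simps)
    have notS: "i \<in> wav_idx" "i \<notin> S n" "cutoff n < fst i" if "i \<in> levels N - S n" for i
      using that levels_subset by (auto simp: S_def)
    show "0 \<le> 2 * c2 * (1 / 4) ^ fst i \<and> 2 * c2 * (1 / 4) ^ fst i \<le> 1 \<and>
        1 - 2 * c2 * (1 / 4) ^ fst i \<le> measure H {u. scale i * u \<in> box n i}" if i: "i \<in> levels N - S n" for i
    proof (intro conjI tail_prob notS[OF i] cut)
      have "(1 / 4 :: real) ^ fst i \<le> (1 / 2) ^ fst i" by (intro power_mono) auto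
      also have "\<dots> \<le> (1 / 2) ^ cutoff n" using notS(3)[OF i] by (intro power_decreasing) auto
      finally have "2 * c2 * (1 / 4) ^ fst i \<le> 2 * c2 * (1 / 2) ^ cutoff n"
        using c2 by (intro mult_left_mono) auto
      with half show "2 * c2 * (1 / 4) ^ fst i \<le> 1" by linarith
    qed (use c2 in auto)
    have "(\<Sum>i\<in>levels N - S n. 2 * c2 * (1 / 4) ^ fst i)
        \<le> (\<Sum>i\<in>{i \<in> levels N. cutoff n < fst i}. 2 * c2 * (1 / 4) ^ fst i)"
      using notS c2 by (intro sum_mono2) auto
    also have "\<dots> \<le> 2 * c2 * (1 / 2) ^ cutoff n"
      unfolding sum_distrib_left[symmetric] using c2
      by (intro mult_left_mono sum_levels_geometric_tail_le) auto
    finally show "(\<Sum>i\<in>levels N - S n. 2 * c2 * (1 / 4) ^ fst i) \<le> 1 / 2"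
      using half by linarith
  qed auto
  show E: "E \<in> sets coeff_borel" unfolding E_def by (rule prior_box_ge(1)[OF meas c])
  have "?c \<le> measure prior E" unfolding E_def by (rule prior_box_ge(2)[OF meas c])
  then show "exp (- C_coeff * (2 + M) * (K n * LL n)) / 2 \<le> measure prior E"
    by (simp add: powr_def mult_ac)
  fix f assume "f \<in> E"
  then have f: "\<And>i. i \<in> wav_idx \<Longrightarrow> f i \<in> box n i" by (simp add: E_def)
  note dist = box_distance[OF n1 f]
  show "infsum (\<lambda>i. (f i - f0 i)\<^sup>2) wav_idx \<le> (6 + 3 * M) * K n / real n"
    using infsum_square_le[of "\<lambda>i. f i - f0 i"] dist by simp
  have "(\<lambda>i. f i - f0 i) \<in> l2_space" unfolding l2_space_iff_bounded using dist by blast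
  moreover have "(\<lambda>i. - f0 i) \<in> l2_space" using f0_l2 by (simp add: l2_space_def)
  ultimately show "f \<in> l2_space" using l2_space_diff[of "\<lambda>i. f i - f0 i" "\<lambda>i. - f0 i"] by simp
qed

end

lemma eventually_K_ge: "eventually (\<lambda>n. b \<le> K n) sequentially"
proof (rule eventually_sequentiallyI[of "nat \<lceil>max b 1 powr (2 * \<beta> + 1)\<rceil>"])
  fix n assume "nat \<lceil>max b 1 powr (2 * \<beta> + 1)\<rceil> \<le> n"
  then have "max b 1 powr (2 * \<beta> + 1) \<le> real n" by linarith
  then have "(max b 1 powr (2 * \<beta> + 1)) powr (1 / (2 * \<beta> + 1)) \<le> K n"
    unfolding K_def using \<beta> by (intro powr_mono2) auto
  then show "b \<le> K n" using \<beta> by (simp add: powr_powr)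
qed

text \<open>The cutoff grows without bound together with \<open>K n\<close>, so the conditions of
  \<open>prior_mass\<close> hold for all large \<open>n\<close>.\<close>

lemma eventually_cutoff:
  "eventually (\<lambda>n. 3 \<le> n \<and> \<beta> + 5 / 2 \<le> real (cutoff n) \<and> 4 * c2 \<le> 2 ^ cutoff n) sequentially"
proof -
  obtain m1 where m1: "\<beta> + 5 / 2 \<le> real m1" using real_arch_simple by blast
  obtain m2 where m2: "4 * c2 < 2 ^ m2" using real_arch_pow[of 2 "4 * c2"] by auto
  define m where "m = max m1 m2"
  show ?thesis
    using eventually_ge_at_top[of 3] eventually_K_ge[of "2 ^ Suc m"]
  proof eventually_elim
    case (elim n)
    then have "(2::real) ^ Suc m < 2 ^ Suc (cutoff n)" using cutoff_gt[of n] by linarith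
    then have mc: "m \<le> cutoff n" by (simp add: power_strict_increasing_iff)
    then have "m1 \<le> cutoff n" "m2 \<le> cutoff n" by (auto simp: m_def)
    then have "(2::real) ^ m2 \<le> 2 ^ cutoff n" by (intro power_increasing) auto
    then show ?case using elim m1 m2 \<open>m1 \<le> cutoff n\<close> by linarith
  qed
qed

end

text \<open>The logarithmic power \<open>2 + \<kappa>\<close> makes \<open>n * \<tau>^2\<close>
  exceed the prior-mass exponent, of order \<open>K n * LL n\<close>, by the factor
  \<open>(ln n)^2\<close>. In \<open>b\<close> the first summand comes from the radius of the
  neighbourhood, the second from its prior mass. The bound is uniform over all versions of the
  likelihood.\<close>

lemma (in heavy_tailed_prior) posterior_contraction_rate:
  assumes \<rho>: "0 < \<rho>" "\<rho> < 1" and f0_space: "f0 \<in> space coeff_borel"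
  defines "a \<equiv> \<rho> * (1 - \<rho>) / 4" and "b \<equiv> \<rho> * (1 + \<rho>) * (6 + 3 * M) / 2 + C_coeff * (2 + M)"
  shows "eventually (\<lambda>n. \<forall>\<mu> p. is_likelihood n \<mu> p \<longrightarrow>
    (\<integral>\<^sup>+X. tempered_posterior \<rho> p prior X {f \<in> space coeff_borel. l2_norm (\<lambda>i. f i - f0 i)
        > ennreal (ln (real n) powr (2 + \<kappa>) * real n powr (- \<beta> / (2 * \<beta> + 1)))} \<partial>white_noise n f0)
      \<le> ennreal (3 * exp (- (a * (ln (real n))\<^sup>2 - b)))) sequentially"
proof -
  have a: "0 < a" using \<rho> by (simp add: a_def)
  have "filterlim (\<lambda>n. a * (ln (real n))\<^sup>2) at_top sequentially"
    using a by real_asymp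
  then have "eventually (\<lambda>n. b \<le> a * (ln (real n))\<^sup>2) sequentially"
    by (simp add: filterlim_at_top)
  then show ?thesis using eventually_cutoff
  proof eventually_elim
    case (elim n)
    then have n3: "3 \<le> n" and cut: "\<beta> + 5 / 2 \<le> real (cutoff n)" "4 * c2 \<le> 2 ^ cutoff n" by auto
    note n1 = n1[OF n3]
    note mass = prior_mass[OF n3 cut]
    let ?\<tau> = "ln (real n) powr (2 + \<kappa>) * real n powr (- \<beta> / (2 * \<beta> + 1))"
    let ?X = "K n * LL n"
    \<comment> \<open>Of the exponent \<open>4 + 2 * \<kappa>\<close> of \<open>ln n\<close> in the
      square, \<open>2 + 2 * \<kappa>\<close> matches \<open>LL n\<close>, and the remaining 2 is
      the gain.\<close>
    have \<tau>: "real n * ?\<tau>\<^sup>2 = (ln (real n))\<^sup>2 * ?X"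
    proof -
      have "(ln (real n) powr (2 + \<kappa>))\<^sup>2 = ln (real n) powr (2 + (2 + 2 * \<kappa>))"
        by (simp add: power2_eq_square powr_add[symmetric])
      also have "\<dots> = (ln (real n))\<^sup>2 * LL n"
        unfolding powr_add[of _ 2] LL_def using ln_ge_1[OF n3] by simp
      finally have "(ln (real n) powr (2 + \<kappa>))\<^sup>2 = (ln (real n))\<^sup>2 * LL n" .
      moreover have "real n * (real n powr (- \<beta> / (2 * \<beta> + 1)))\<^sup>2 = K n"
      proof -
        have "real n * (real n powr (- \<beta> / (2 * \<beta> + 1)))\<^sup>2
          = real n powr 1 * real n powr (- \<beta> / (2 * \<beta> + 1) + - \<beta> / (2 * \<beta> + 1))"
          unfolding powr_add[of _ "- \<beta> / (2 * \<beta> + 1)"] by (simp add: power2_eq_square)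
        also have "\<dots> = real n powr (1 + (- \<beta> / (2 * \<beta> + 1) + - \<beta> / (2 * \<beta> + 1)))"
          by (rule powr_add[symmetric])
        also have "1 + (- \<beta> / (2 * \<beta> + 1) + - \<beta> / (2 * \<beta> + 1)) = 1 / (2 * \<beta> + 1)"
          using \<beta> by (simp add: divide_simps)
        finally show ?thesis by (simp add: K_def)
      qed
      ultimately show ?thesis by (simp add: power_mult_distrib mult_ac)
    qed
    have X: "K n \<le> ?X" "1 \<le> ?X"
    proof -
      show "K n \<le> ?X" using mult_left_mono[OF LL_ge(2)[OF n3], of "K n"] K_ge_1[OF n1] by simp
      then show "1 \<le> ?X" using K_ge_1[OF n1] by linarith
    qed
    let ?w = "exp (- C_coeff * (2 + M) * ?X) / 2"
    let ?A = "(6 + 3 * M) * K n / real n"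
    have "exp (- \<rho> * (1 - \<rho>) * real n * ?\<tau>\<^sup>2 / 4) * (1 + exp (\<rho> * (1 + \<rho>) * real n * ?A / 2) / ?w)
      \<le> 3 * exp (- (a * (ln (real n))\<^sup>2 - b))"
    proof -
      let ?P = "\<rho> * (1 + \<rho>) * (6 + 3 * M) / 2"
      have P: "0 \<le> ?P" using \<rho> M_pos by simp
      have b: "0 \<le> b" unfolding b_def using P C_coeff_pos M_pos by simp
      have e1: "exp (- \<rho> * (1 - \<rho>) * real n * ?\<tau>\<^sup>2 / 4) = exp (- (a * (ln (real n))\<^sup>2 * ?X))"
      proof -
        have "- \<rho> * (1 - \<rho>) * real n * ?\<tau>\<^sup>2 / 4 = - (a * (real n * ?\<tau>\<^sup>2))" by (simp add: a_def)
        then show ?thesis unfolding \<tau> by (simp add: mult.assoc)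
      qed
      have "exp (\<rho> * (1 + \<rho>) * real n * ?A / 2) / ?w = 2 * exp (?P * K n + C_coeff * (2 + M) * ?X)"
      proof -
        have e: "\<rho> * (1 + \<rho>) * real n * ?A / 2 = ?P * K n" using n1 by (simp add: field_simps)
        have w: "- C_coeff * (2 + M) * ?X = - (C_coeff * (2 + M) * ?X)" by simp
        have "exp x / (exp (- y) / 2) = 2 * exp (x + y)" for x y :: real
          by (simp add: exp_add exp_minus field_simps)
        then show ?thesis unfolding e w .
      qed
      also have "\<dots> \<le> 2 * exp (b * ?X)"
        using mult_left_mono[OF X(1) P] by (simp add: b_def distrib_right)
      finally have "exp (\<rho> * (1 + \<rho>) * real n * ?A / 2) / ?w \<le> 2 * exp (b * ?X)" .
      moreover have "0 \<le> b * ?X" using X(2) by (rule mult_nonneg_nonneg[OF b, OF order_trans[OF zero_le_one]])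
      then have "1 \<le> exp (b * ?X)" by simp
      ultimately have "1 + exp (\<rho> * (1 + \<rho>) * real n * ?A / 2) / ?w \<le> 3 * exp (b * ?X)"
        by linarith
      then have "exp (- \<rho> * (1 - \<rho>) * real n * ?\<tau>\<^sup>2 / 4) * (1 + exp (\<rho> * (1 + \<rho>) * real n * ?A / 2) / ?w)
        \<le> exp (- (a * (ln (real n))\<^sup>2 * ?X)) * (3 * exp (b * ?X))"
        unfolding e1 by (intro mult_left_mono) auto
      also have "\<dots> = 3 * exp (- ((a * (ln (real n))\<^sup>2 - b) * ?X))"
        by (simp add: exp_add[symmetric] algebra_simps)
      \<comment> \<open>The bracket is nonnegative for large \<open>n\<close> and
        \<open>K n * LL n\<close> is at least 1, so that factor may be dropped.\<close>
      also have "\<dots> \<le> 3 * exp (- ((a * (ln (real n))\<^sup>2 - b) * 1))"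
        using elim(1) X(2) by (intro mult_left_mono exp_le_cancel_iff[THEN iffD2] le_imp_neg_le) auto
      finally show ?thesis by simp
    qed
    then have final: "ennreal (exp (- \<rho> * (1 - \<rho>) * real n * ?\<tau>\<^sup>2 / 4) * (1 + exp (\<rho> * (1 + \<rho>) * real n * ?A / 2) / ?w))
      \<le> ennreal (3 * exp (- (a * (ln (real n))\<^sup>2 - b)))" by (rule ennreal_leI)
    show ?case
    proof (intro allI impI)
      fix \<mu> p assume lik: "is_likelihood n \<mu> p"
      show "(\<integral>\<^sup>+X. tempered_posterior \<rho> p prior X {f \<in> space coeff_borel. l2_norm (\<lambda>i. f i - f0 i)
          > ennreal ?\<tau>} \<partial>white_noise n f0) \<le> ennreal (3 * exp (- (a * (ln (real n))\<^sup>2 - b)))"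
        by (rule order_trans[OF tempered_posterior_bound[OF n1 lik f0_l2 f0_space prob_space_prior
                sets_prior AE_prior_l2_space \<rho> _ mass(1,3,4) _ mass(2)] final]) auto
    qed
  qed
qed

theorem theorem10:
  fixes h :: "real \<Rightarrow> real" and c1 \<kappa> c2 \<beta> L r \<rho> :: real and f0 :: coeffs
  assumes h_meas: "h \<in> borel_measurable borel"
    and h_prob: "(\<integral>\<^sup>+x. ennreal (h x) \<partial>lborel) = 1"
    and h_sym: "\<And>x. h (- x) = h x"
    and h_pos: "\<And>x. 0 < h x"
    and h_bdd: "bounded (range h)"
    and h_decr: "antimono_on {0..} h"
    and c1: "0 < c1" and \<kappa>: "0 \<le> \<kappa>"
    and h_log: "\<And>x. 0 \<le> x \<Longrightarrow> ln (1 / h x) \<le> c1 * (1 + ln (1 + x) powr (1 + \<kappa>))"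
    and c2: "0 < c2"
    and h_tail: "\<And>x. 1 \<le> x \<Longrightarrow> (LBINT u:{x..}. h u) \<le> c2 / x\<^sup>2"
    and \<beta>: "0 < \<beta>" and L: "0 < L" and r: "1 \<le> r" "r \<le> 2"
    and \<beta>r: "1 / r - 1 / 2 < \<beta>"
    and f0: "f0 \<in> besov_ball \<beta> r L"
    and \<rho>: "0 < \<rho>" "\<rho> < 1"
  shows "\<exists>d>0. \<forall>\<mu> p. (\<forall>n\<ge>1. is_likelihood n (\<mu> n) (p n)) \<longrightarrow>
    ((\<lambda>n. \<integral>\<^sup>+X. tempered_posterior \<rho> (p n) (series_prior (\<lambda>l. 2 powr (- (real l)\<^sup>2)) h) X
              {f \<in> space coeff_borel. l2_norm (\<lambda>i. f i - f0 i)
                 > ennreal (ln (real n) powr d * real n powr (- \<beta> / (2 * \<beta> + 1)))}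
            \<partial>white_noise n f0) \<longlonglongrightarrow> 0)"
proof -
  \<comment> \<open>Likelihoods are only measurable on \<open>space coeff_borel\<close>, the functions that are
    \<open>undefined\<close> off the index set; \<open>f0\<close> need not be one of them.\<close>
  define g0 where "g0 = restrict f0 wav_idx"
  have g0_eq: "g0 i = f0 i" if "i \<in> wav_idx" for i using that by (simp add: g0_def)
  have g0_space: "g0 \<in> space coeff_borel" by (simp add: g0_def space_PiM)
  have "(\<Sum>k<2 ^ l. \<bar>g0 (l, k)\<bar> powr r) = (\<Sum>k<2 ^ l. \<bar>f0 (l, k)\<bar> powr r)" for l
    by (intro sum.cong) (auto simp: g0_eq wav_idx_def)
  then have g0_besov: "g0 \<in> besov_ball \<beta> r L" using f0 by (simp add: besov_ball_def)
  have wn: "white_noise n f0 = white_noise n g0" for n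
    unfolding white_noise_def by (intro PiM_cong) (auto simp: g0_eq)
  have norm: "l2_norm (\<lambda>i. f i - f0 i) = l2_norm (\<lambda>i. f i - g0 i)" for f
  proof -
    have "(f i - f0 i)\<^sup>2 = (f i - g0 i)\<^sup>2" if "i \<in> wav_idx" for i using that by (simp add: g0_eq)
    then show ?thesis
      unfolding l2_norm_def l2_space_def by (simp cong: summable_on_cong infsum_cong)
  qed
  interpret heavy_tailed_prior h c1 \<kappa> c2 \<beta> L r g0
    by unfold_locales (use assms g0_besov in auto)
  let ?a = "\<rho> * (1 - \<rho>) / 4"
  let ?b = "\<rho> * (1 + \<rho>) * (6 + 3 * M) / 2 + C_coeff * (2 + M)"
  have exp_lim: "(\<lambda>n. 3 * exp (- (a * (ln (real n))\<^sup>2 - b))) \<longlonglongrightarrow> 0" if "0 < a" for a b :: real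
    using that by real_asymp
  have "0 < ?a" using \<rho> by simp
  from tendsto_ennrealI[OF exp_lim[OF this, of ?b]]
  have bound_lim: "(\<lambda>n. ennreal (3 * exp (- (?a * (ln (real n))\<^sup>2 - ?b)))) \<longlonglongrightarrow> 0"
    by (simp only: ennreal_0)
  show ?thesis
  \<comment> \<open>The power \<open>1 + \<kappa>\<close> only matches the prior-mass exponent; the
    additional 1 makes the posterior bound tend to 0 for every constant \<open>?b\<close>.\<close>
  proof (intro exI[of _ "2 + \<kappa>"] conjI allI impI)
    show "0 < 2 + \<kappa>" using \<kappa> by simp
    fix \<mu> p assume lik: "\<forall>n\<ge>1. is_likelihood n (\<mu> n) (p n)"
    show "(\<lambda>n. \<integral>\<^sup>+X. tempered_posterior \<rho> (p n) prior X
              {f \<in> space coeff_borel. l2_norm (\<lambda>i. f i - f0 i)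
                 > ennreal (ln (real n) powr (2 + \<kappa>) * real n powr (- \<beta> / (2 * \<beta> + 1)))}
            \<partial>white_noise n f0) \<longlonglongrightarrow> 0"
      unfolding wn norm
    proof (rule tendsto_sandwich[OF _ _ tendsto_const bound_lim])
      show "eventually (\<lambda>n. (\<integral>\<^sup>+X. tempered_posterior \<rho> (p n) prior X
              {f \<in> space coeff_borel. l2_norm (\<lambda>i. f i - g0 i)
                 > ennreal (ln (real n) powr (2 + \<kappa>) * real n powr (- \<beta> / (2 * \<beta> + 1)))}
            \<partial>white_noise n g0) \<le> ennreal (3 * exp (- (?a * (ln (real n))\<^sup>2 - ?b)))) sequentially"
        using posterior_contraction_rate[OF \<rho> g0_space] eventually_ge_at_top[of 1]
        by eventually_elim (use lik in blast)
    qed auto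
  qed
qed

end
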